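(* Let $m\ge1$ and $\ell\ge1$ be integers and let $X$ be a $\mathcal D$-measurable $D([0,1]^m)$-valued random variable. Then the following are equivalent. (i) The projective moment $\mathbb E[X^{\widehat\otimes\ell}]$ exists in Bochner sense. (ii) The injective moment $\mathbb E[X^{\check\otimes\ell}]$ exists in Bochner sense. (iii) $\mathbb E\|X\|^\ell<\infty$ and there exist (non-random) countable subsets $A_1,\dots,A_m$ of $[0,1]$ such that for every $i\le m$, almost surely $\Delta_iX(t)=0$ for all $t=(t_1,\dots,t_m)\in[0,1]^m$ with $t_i\notin A_i$.
   Context: $D([0,1]^m)$ is the set of functions $f:[0,1]^m\to\mathbb R$ such that at every $t=(t_1,\dots,t_m)\in[0,1]^m$ the limit of $f(s)$ exists (as a finite real number) as $s\to t$ within each set $J_1\times\dots\times J_m$, where each $J_i$ is either $[t_i,1]$ or $[0,t_i)$ (the latter only if $t_i>0$). It is a Banach space with the norm $\|f\|=\sup_{t\in[0,1]^m}|f(t)|$. $\mathcal D$ is the $\sigma$-field on it generated by all point evaluations $f\mapsto f(t)$. A $\mathcal D$-measurable $D([0,1]^m)$-valued random variable is a map $X$ from a probability space $(\Omega,\mathcal F,\mathbb P)$ to $D([0,1]^m)$ such that $X(t)$ is a real random variable for each $t\in[0,1]^m$. For $f\in D([0,1]^m)$ and $1\le i\le m$, $\Delta_if(t):=f(t)-\lim_{s\nearrow t_i,\,s<t_i}f(t_1,\dots,s,\dots,t_m)$ ($s$ in position $i$) if $t_i>0$, and $\Delta_if(t):=0$ if $t_i=0$. For a Banach space $B$, $B^{\widehat\otimes\ell}$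 and $B^{\check\otimes\ell}$ denote the $\ell$-fold projective and injective (completed) tensor powers of $B$. For a $B$-valued $X$, write $X^{\widehat\otimes\ell}$ or $X^{\check\otimes\ell}$ for $X\otimes\dots\otimes X$ ($\ell$ factors) regarded as a function $\Omega\to B^{\widehat\otimes\ell}$ or $\Omega\to B^{\check\otimes\ell}$. The projective (injective) moment exists in Bochner sense if this function is Bochner integrable with respect to $\mathbb P$ in $B^{\widehat\otimes\ell}$ (respectively $B^{\check\otimes\ell}$), i.e. it is almost surely a norm limit of a sequence of measurable simple functions and its norm has finite integral. Here $B=D([0,1]^m)$. *)

theory Defs
  imports "HOL-Probability.Probability"
begin

section \<open>The space \<open>D([0,1]\<^sup>m)\<close>\<close>

text \<open>The octant of the unit cube at \<open>t\<close> is \<open>J\<^sub>1 \<times> \<dots> \<times> J\<^sub>m\<close> with \<open>J\<^sub>i = [0, t\<^sub>i)\<close> for \<open>i \<in> L\<close> and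
  \<open>J\<^sub>i = [t\<^sub>i, 1]\<close> for \<open>i \<notin> L\<close>.\<close>

definition octant :: "real ^ 'm \<Rightarrow> 'm set \<Rightarrow> (real ^ 'm) set" where
  "octant t L = {s. \<forall>i. s $ i \<in> (if i \<in> L then {0..<t $ i} else {t $ i..1})}"

text \<open>The filter \<open>nhds t \<sqinter> principal J\<close> is used instead of \<open>at t within J\<close>, since the latter
  excludes the point \<open>t\<close> itself.  The octant with \<open>L = {}\<close> contains \<open>t\<close>, so that the existence of
  the limit there means continuity from the upper right.\<close>

definition has_octant_limits :: "(real ^ 'm \<Rightarrow> real) \<Rightarrow> bool" where
  "has_octant_limits f \<longleftrightarrow> (\<forall>t\<in>cbox 0 1. \<forall>L. (\<forall>i\<in>L. 0 < t $ i) \<longrightarrow>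
     (\<exists>l. (f \<longlongrightarrow> l) (inf (nhds t) (principal (octant t L)))))"

text \<open>Functions on the cube are represented by their extension by zero to the whole space.\<close>

definition skorokhod_functions :: "(real ^ 'm \<Rightarrow> real) set" where
  "skorokhod_functions = {f. has_octant_limits f \<and> (\<forall>t. t \<notin> cbox 0 1 \<longrightarrow> f t = 0)}"

lemma skorokhod_functions_const0: "(\<lambda>_. 0) \<in> skorokhod_functions"
  by (auto simp: skorokhod_functions_def has_octant_limits_def)

lemma skorokhod_functions_add:
  assumes "f \<in> skorokhod_functions" "g \<in> skorokhod_functions"
  shows "(\<lambda>t. f t + g t) \<in> skorokhod_functions"
proof -
  have "\<exists>l. ((\<lambda>t. f t + g t) \<longlongrightarrow> l) F"
    if "\<exists>l. (f \<longlongrightarrow> l) F" "\<exists>l. (g \<longlongrightarrow> l) F" for F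
    using that tendsto_add by blast
  then show ?thesis using assms by (simp add: skorokhod_functions_def has_octant_limits_def)
qed

lemma skorokhod_functions_scale:
  assumes "f \<in> skorokhod_functions"
  shows "(\<lambda>t. c * f t) \<in> skorokhod_functions"
proof -
  have "\<exists>l. ((\<lambda>t. c * f t) \<longlongrightarrow> l) F" if "\<exists>l. (f \<longlongrightarrow> l) F" for F
    using that tendsto_mult_left by blast
  then show ?thesis using assms by (simp add: skorokhod_functions_def has_octant_limits_def)
qed

lemma skorokhod_functions_bounded:
  fixes f :: "real ^ 'm \<Rightarrow> real"
  assumes "f \<in> skorokhod_functions"
  shows "bdd_above ((\<lambda>t. \<bar>f t\<bar>) ` cbox 0 1)"
proof -
  have loc: "\<exists>U B. open U \<and> t \<in> U \<and> (\<forall>s\<in>U \<inter> cbox 0 1. \<bar>f s\<bar> \<le> B)" if t: "t \<in> cbox 0 1" for t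
  proof -
    let ?S = "{L. \<forall>i\<in>L. 0 < t $ i}"
    have "\<forall>L\<in>?S. \<exists>l. (f \<longlongrightarrow> l) (inf (nhds t) (principal (octant t L)))"
      using assms t by (auto simp: skorokhod_functions_def has_octant_limits_def)
    from bchoice[OF this] obtain l
      where l: "\<And>L. L \<in> ?S \<Longrightarrow> (f \<longlongrightarrow> l L) (inf (nhds t) (principal (octant t L)))"
      by blast
    have "\<forall>L\<in>?S. \<forall>\<^sub>F s in nhds t. s \<in> octant t L \<longrightarrow> \<bar>f s - l L\<bar> < 1"
      using tendstoD[OF l, of _ 1] by (auto simp: eventually_inf_principal dist_real_def)
    then have "\<forall>\<^sub>F s in nhds t. \<forall>L\<in>?S. s \<in> octant t L \<longrightarrow> \<bar>f s - l L\<bar> < 1"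
      by (intro eventually_ball_finite) auto
    then obtain U where U: "open U" "t \<in> U"
      "\<And>s L. s \<in> U \<Longrightarrow> L \<in> ?S \<Longrightarrow> s \<in> octant t L \<Longrightarrow> \<bar>f s - l L\<bar> < 1"
      unfolding eventually_nhds by auto
    have "\<bar>f s\<bar> \<le> 1 + (\<Sum>L\<in>?S. \<bar>l L\<bar>)" if s: "s \<in> U \<inter> cbox 0 1" for s
    proof -
      let ?L = "{i. s $ i < t $ i}"
      have L: "?L \<in> ?S" "s \<in> octant t ?L"
        using s by (auto simp: mem_box_cart octant_def intro: le_less_trans)
      have "\<bar>l ?L\<bar> \<le> (\<Sum>L\<in>?S. \<bar>l L\<bar>)"
        using L(1) by (intro member_le_sum) auto
      moreover have "\<bar>f s - l ?L\<bar> < 1"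
        using U(3) s L by blast
      ultimately show ?thesis by linarith
    qed
    then show ?thesis using U by blast
  qed
  then obtain U B where UB: "\<And>t. t \<in> cbox 0 1 \<Longrightarrow> open (U t)" "\<And>t. t \<in> cbox 0 1 \<Longrightarrow> t \<in> U t"
    "\<And>t s. t \<in> cbox 0 1 \<Longrightarrow> s \<in> U t \<inter> cbox 0 1 \<Longrightarrow> \<bar>f s\<bar> \<le> B t"
    by metis
  obtain C where C: "C \<subseteq> cbox 0 1" "finite C" "cbox 0 1 \<subseteq> (\<Union>t\<in>C. U t)"
    by (rule compactE_image[OF compact_cbox[of 0 "1 :: real ^ 'm"], of "cbox 0 1" U]) (use UB in auto)
  have "\<bar>f s\<bar> \<le> (\<Sum>t\<in>C. \<bar>B t\<bar>)" if s: "s \<in> cbox 0 1" for s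
  proof -
    obtain t where t: "t \<in> C" "s \<in> U t" using C s by blast
    then have "\<bar>f s\<bar> \<le> \<bar>B t\<bar>" using UB(3)[of t s] C s by fastforce
    also have "\<dots> \<le> (\<Sum>t\<in>C. \<bar>B t\<bar>)" using t C by (intro member_le_sum) auto
    finally show ?thesis .
  qed
  then show ?thesis by (intro bdd_aboveI2)
qed

typedef 'm::finite skorokhod = "skorokhod_functions :: (real ^ 'm \<Rightarrow> real) set"
  morphisms skorokhod_apply Abs_skorokhod
  using skorokhod_functions_const0 by blast

setup_lifting type_definition_skorokhod

instantiation skorokhod :: (finite) real_vector
begin

lift_definition zero_skorokhod :: "'a skorokhod" is "\<lambda>_. 0"
  by (rule skorokhod_functions_const0)

lift_definition plus_skorokhod :: "'a skorokhod \<Rightarrow> 'a skorokhod \<Rightarrow> 'a skorokhod"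
  is "\<lambda>f g t. f t + g t"
  by (rule skorokhod_functions_add)

lift_definition scaleR_skorokhod :: "real \<Rightarrow> 'a skorokhod \<Rightarrow> 'a skorokhod"
  is "\<lambda>c f t. c * f t"
  by (rule skorokhod_functions_scale)

lift_definition uminus_skorokhod :: "'a skorokhod \<Rightarrow> 'a skorokhod" is "\<lambda>f t. - f t"
proof -
  show "(\<lambda>t. - f t) \<in> skorokhod_functions" if "f \<in> skorokhod_functions" for f :: "real ^ 'a \<Rightarrow> real"
    using skorokhod_functions_scale[OF that, of "- 1"] by simp
qed

lift_definition minus_skorokhod :: "'a skorokhod \<Rightarrow> 'a skorokhod \<Rightarrow> 'a skorokhod"
  is "\<lambda>f g t. f t - g t"
proof -
  show "(\<lambda>t. f t - g t) \<in> skorokhod_functions"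
    if "f \<in> skorokhod_functions" "g \<in> skorokhod_functions" for f g :: "real ^ 'a \<Rightarrow> real"
    using skorokhod_functions_add[OF that(1) skorokhod_functions_scale[OF that(2), of "- 1"]] by simp
qed

instance
  by standard (transfer; simp add: fun_eq_iff algebra_simps)+

end

lemma zero_in_unit_cube: "(0 :: real ^ 'm) \<in> cbox 0 1"
  by (simp add: mem_box_cart)

instantiation skorokhod :: (finite) real_normed_vector
begin

definition norm_skorokhod :: "'a skorokhod \<Rightarrow> real" where
  "norm_skorokhod f = (SUP t\<in>cbox 0 1. \<bar>skorokhod_apply f t\<bar>)"

definition dist_skorokhod :: "'a skorokhod \<Rightarrow> 'a skorokhod \<Rightarrow> real" where
  "dist_skorokhod f g = norm (f - g)"

definition sgn_skorokhod :: "'a skorokhod \<Rightarrow> 'a skorokhod" where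
  "sgn_skorokhod f = f /\<^sub>R norm f"

definition uniformity_skorokhod :: "('a skorokhod \<times> 'a skorokhod) filter" where
  "uniformity_skorokhod = (INF e\<in>{0<..}. principal {(f, g). dist f g < e})"

definition open_skorokhod :: "'a skorokhod set \<Rightarrow> bool" where
  "open_skorokhod U \<longleftrightarrow> (\<forall>f\<in>U. eventually (\<lambda>(f', g). f' = f \<longrightarrow> g \<in> U) uniformity)"

lemma abs_skorokhod_le_norm: "\<bar>skorokhod_apply f t\<bar> \<le> norm f"
proof (cases "t \<in> cbox 0 1")
  case True
  then show ?thesis
    using skorokhod_functions_bounded[OF skorokhod_apply[of f]]
    by (auto simp: norm_skorokhod_def intro!: cSUP_upper)
next
  case False
  have "0 \<le> \<bar>skorokhod_apply f 0\<bar>" by simp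
  also have "\<dots> \<le> norm f"
    using skorokhod_functions_bounded[OF skorokhod_apply[of f]] zero_in_unit_cube
    unfolding norm_skorokhod_def by (intro cSUP_upper)
  finally show ?thesis
    using False skorokhod_apply[of f] by (simp add: skorokhod_functions_def)
qed

lemma norm_skorokhod_le:
  "(\<And>t. t \<in> cbox 0 1 \<Longrightarrow> \<bar>skorokhod_apply f t\<bar> \<le> b) \<Longrightarrow> norm f \<le> b"
  unfolding norm_skorokhod_def using zero_in_unit_cube by (intro cSUP_least) blast+

instance
proof
  fix f g :: "'a skorokhod" and c :: real
  show "norm f = 0 \<longleftrightarrow> f = 0"
  proof
    assume "norm f = 0"
    then have "skorokhod_apply f t = 0" for t using abs_skorokhod_le_norm[of f t] by simp
    then show "f = 0" by (simp add: skorokhod_apply_inject[symmetric] zero_skorokhod.rep_eq fun_eq_iff)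
  next
    assume "f = 0"
    then have "norm f \<le> 0" by (intro norm_skorokhod_le) (simp add: zero_skorokhod.rep_eq)
    then show "norm f = 0" using abs_skorokhod_le_norm[of f 0] by linarith
  qed
  show "norm (f + g) \<le> norm f + norm g"
    using abs_skorokhod_le_norm[of f] abs_skorokhod_le_norm[of g]
    by (intro norm_skorokhod_le)
       (auto simp: plus_skorokhod.rep_eq intro!: order_trans[OF abs_triangle_ineq] add_mono)
  have le: "norm (c *\<^sub>R f) \<le> \<bar>c\<bar> * norm f" for c and f :: "'a skorokhod"
    using abs_skorokhod_le_norm[of f]
    by (intro norm_skorokhod_le) (auto simp: scaleR_skorokhod.rep_eq abs_mult intro!: mult_left_mono)
  show "norm (c *\<^sub>R f) = \<bar>c\<bar> * norm f"
  proof (cases "c = 0")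
    case True
    then show ?thesis using le[of c f] abs_skorokhod_le_norm[of "c *\<^sub>R f" 0] by simp
  next
    case False
    have "norm f = norm (inverse c *\<^sub>R (c *\<^sub>R f))" using False by simp
    also have "\<dots> \<le> \<bar>inverse c\<bar> * norm (c *\<^sub>R f)" by (rule le)
    finally show ?thesis using le[of c f] False by (simp add: field_simps)
  qed
qed (simp_all add: dist_skorokhod_def sgn_skorokhod_def uniformity_skorokhod_def open_skorokhod_def)

end

instance skorokhod :: (finite) banach
proof
  fix F :: "nat \<Rightarrow> 'a skorokhod"
  assume F: "Cauchy F"
  let ?f = "\<lambda>n. skorokhod_apply (F n)"
  have diff: "\<bar>?f m t - ?f n t\<bar> \<le> dist (F m) (F n)" for m n t
    using abs_skorokhod_le_norm[of "F m - F n" t] by (simp add: dist_norm minus_skorokhod.rep_eq)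
  have "Cauchy (\<lambda>n. ?f n t)" for t
    using F unfolding Cauchy_def by (metis diff dist_real_def le_less_trans)
  define g where "g t = lim (\<lambda>n. ?f n t)" for t
  have g: "(\<lambda>n. ?f n t) \<longlonglongrightarrow> g t" for t
    using Cauchy_convergent[OF \<open>Cauchy (\<lambda>n. ?f n t)\<close>] by (simp add: g_def convergent_LIMSEQ_iff)
  have unif: "\<exists>N. \<forall>n\<ge>N. \<forall>t. \<bar>?f n t - g t\<bar> \<le> e" if "e > 0" for e :: real
  proof -
    obtain N where N: "\<And>m n. m \<ge> N \<Longrightarrow> n \<ge> N \<Longrightarrow> dist (F m) (F n) < e"
      using F \<open>e > 0\<close> unfolding Cauchy_def by blast
    have "\<bar>?f n t - g t\<bar> \<le> e" if "n \<ge> N" for n t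
    proof (rule tendsto_upperbound)
      show "(\<lambda>k. \<bar>?f n t - ?f k t\<bar>) \<longlonglongrightarrow> \<bar>?f n t - g t\<bar>" by (intro tendsto_intros g)
      show "\<forall>\<^sub>F k in sequentially. \<bar>?f n t - ?f k t\<bar> \<le> e"
        using eventually_ge_at_top[of N]
        by eventually_elim (use N that diff in \<open>meson less_imp_le order_trans\<close>)
    qed simp
    then show ?thesis by blast
  qed
  have "has_octant_limits g"
    unfolding has_octant_limits_def
  proof (intro ballI allI impI)
    fix t :: "real ^ 'a" and L :: "'a set"
    assume t: "t \<in> cbox 0 1" and L: "\<forall>i\<in>L. 0 < t $ i"
    let ?G = "inf (nhds t) (principal (octant t L))"
    have "\<exists>l. (?f n \<longlongrightarrow> l) ?G" for n
      using skorokhod_apply[of "F n"] t L by (auto simp: skorokhod_functions_def has_octant_limits_def)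
    then have "\<forall>n. \<exists>l. (?f n \<longlongrightarrow> l) ?G" by blast
    from choice[OF this] obtain l where l: "\<And>n. (?f n \<longlongrightarrow> l n) ?G" by blast
    have "t \<in> closure (octant t L)"
    proof -
      let ?s = "\<lambda>n. (\<chi> i. if i \<in> L then t $ i * (1 - inverse (real (Suc n))) else t $ i) :: real ^ 'a"
      have s: "?s n \<in> octant t L" for n
        using t L by (auto simp: octant_def mem_box_cart field_simps)
      have "?s \<longlonglongrightarrow> t"
      proof (rule vec_tendstoI)
        fix i
        have "(\<lambda>n. t $ i * (1 - inverse (real (Suc n)))) \<longlonglongrightarrow> t $ i * (1 - 0)"
          by (intro tendsto_intros LIMSEQ_inverse_real_of_nat)
        then show "(\<lambda>n. ?s n $ i) \<longlonglongrightarrow> t $ i" by (cases "i \<in> L") simp_all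
      qed
      with s show ?thesis unfolding closure_sequential by (intro exI[of _ ?s] conjI allI)
    qed
    then have nontriv: "?G \<noteq> bot"
      by (auto simp: trivial_limit_def eventually_inf_principal eventually_nhds closure_iff_nhds_not_empty)
    have "Cauchy l"
    proof (rule CauchyI')
      fix e :: real assume "e > 0"
      then obtain N where N: "\<And>m n. m \<ge> N \<Longrightarrow> n \<ge> N \<Longrightarrow> dist (F m) (F n) < e / 2"
        using F unfolding Cauchy_def by (meson half_gt_zero)
      have "dist (l m) (l n) < e" if "m \<ge> N" "n > m" for m n
      proof -
        have "dist (l m) (l n) \<le> e / 2"
        proof (rule tendsto_upperbound[OF tendsto_dist[OF l l] _ nontriv])
          show "\<forall>\<^sub>F s in ?G. dist (?f m s) (?f n s) \<le> e / 2"
          proof (intro always_eventually allI)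
            fix s
            show "dist (?f m s) (?f n s) \<le> e / 2"
              using N[of m n] that diff[of m s n] by (simp add: dist_real_def)
          qed
        qed
        then show ?thesis using \<open>e > 0\<close> by simp
      qed
      then show "\<exists>M. \<forall>m\<ge>M. \<forall>n>m. dist (l m) (l n) < e" by blast
    qed
    then obtain l' where l': "l \<longlonglongrightarrow> l'" using Cauchy_convergent convergent_def by blast
    have "(g \<longlongrightarrow> l') ?G"
    proof (rule tendstoI)
      fix e :: real assume e: "e > 0"
      obtain N where N: "\<And>n t. n \<ge> N \<Longrightarrow> \<bar>?f n t - g t\<bar> \<le> e / 4" using unif[of "e / 4"] e by auto
      obtain N' where N': "\<And>n. n \<ge> N' \<Longrightarrow> dist (l n) l' < e / 4"
        using l' e unfolding lim_sequentially by (meson zero_less_divide_iff zero_less_numeral)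
      let ?n = "max N N'"
      have "\<forall>\<^sub>F s in ?G. dist (?f ?n s) (l ?n) < e / 4" using tendstoD[OF l, of "e / 4"] e by simp
      then show "\<forall>\<^sub>F s in ?G. dist (g s) l' < e"
      proof eventually_elim
        case (elim s)
        have "\<bar>?f ?n s - g s\<bar> \<le> e / 4" "\<bar>l ?n - l'\<bar> < e / 4"
          using N[of ?n s] N'[of ?n] by (auto simp: dist_real_def)
        then show ?case using elim e unfolding dist_real_def by linarith
      qed
    qed
    then show "\<exists>l. (g \<longlongrightarrow> l) ?G" by blast
  qed
  moreover have "g t = 0" if "t \<notin> cbox 0 1" for t
  proof -
    have "?f n t = 0" for n
      using skorokhod_apply[of "F n"] that by (simp add: skorokhod_functions_def)
    then show ?thesis using g[of t] by (simp add: LIMSEQ_const_iff)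
  qed
  ultimately have gD: "g \<in> skorokhod_functions" by (simp add: skorokhod_functions_def)
  have "F \<longlonglongrightarrow> Abs_skorokhod g"
  proof (rule metric_LIMSEQ_I)
    fix e :: real assume e: "e > 0"
    then obtain N where N: "\<And>n t. n \<ge> N \<Longrightarrow> \<bar>?f n t - g t\<bar> \<le> e / 2" using unif[of "e / 2"] by auto
    have "dist (F n) (Abs_skorokhod g) < e" if "n \<ge> N" for n
    proof -
      have "dist (F n) (Abs_skorokhod g) \<le> e / 2"
        unfolding dist_norm using N[OF that]
        by (intro norm_skorokhod_le) (simp add: minus_skorokhod.rep_eq Abs_skorokhod_inverse[OF gD])
      then show ?thesis using e by simp
    qed
    then show "\<exists>N. \<forall>n\<ge>N. dist (F n) (Abs_skorokhod g) < e" by blast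
  qed
  then show "convergent F" by (auto simp: convergent_def)
qed

definition jump :: "'m::finite \<Rightarrow> 'm skorokhod \<Rightarrow> real ^ 'm \<Rightarrow> real" where
  "jump i f t =
     (if 0 < t $ i
      then skorokhod_apply f t -
        Lim (at_left (t $ i)) (\<lambda>s. skorokhod_apply f (\<chi> j. if j = i then s else t $ j))
      else 0)"


section \<open>Completion of a seminormed space\<close>

class seminormed_vector = real_vector +
  fixes seminorm :: "'a \<Rightarrow> real"
  assumes seminorm_triangle: "seminorm (x + y) \<le> seminorm x + seminorm y"
    and seminorm_scaleR: "seminorm (c *\<^sub>R x) = \<bar>c\<bar> * seminorm x"

lemma seminorm_zero [simp]: "seminorm (0 :: 'a::seminormed_vector) = 0"
  using seminorm_scaleR[of 0 "0 :: 'a"] by simp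

lemma seminorm_minus [simp]: "seminorm (- x) = seminorm x"
  using seminorm_scaleR[of "-1" x] by simp

lemma seminorm_minus_commute: "seminorm (x - y) = seminorm (y - x)"
  using seminorm_minus[of "x - y"] by simp

lemma seminorm_nonneg [simp]: "0 \<le> seminorm x"
  using seminorm_triangle[of x "- x"] by simp

lemma seminorm_diff_triangle: "seminorm (x - z) \<le> seminorm (x - y) + seminorm (y - z)"
  using seminorm_triangle[of "x - y" "y - z"] by simp

lemma seminorm_diff_abs: "\<bar>seminorm x - seminorm y\<bar> \<le> seminorm (x - y)"
  using seminorm_triangle[of "x - y" y] seminorm_triangle[of "y - x" x] seminorm_minus_commute[of x y]
  by simp

definition seminorm_cauchy :: "(nat \<Rightarrow> 'a::seminormed_vector) \<Rightarrow> bool" where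
  "seminorm_cauchy X \<longleftrightarrow> (\<forall>e>0. \<exists>N. \<forall>m\<ge>N. \<forall>n\<ge>N. seminorm (X m - X n) < e)"

definition cauchy_equiv :: "(nat \<Rightarrow> 'a::seminormed_vector) \<Rightarrow> (nat \<Rightarrow> 'a) \<Rightarrow> bool" where
  "cauchy_equiv X Y \<longleftrightarrow>
     seminorm_cauchy X \<and> seminorm_cauchy Y \<and> (\<lambda>n. seminorm (X n - Y n)) \<longlonglongrightarrow> 0"

lemma seminorm_cauchy_const: "seminorm_cauchy (\<lambda>_. x)"
  by (simp add: seminorm_cauchy_def)

lemma seminorm_cauchy_add:
  assumes "seminorm_cauchy X" "seminorm_cauchy Y"
  shows "seminorm_cauchy (\<lambda>n. X n + Y n)"
  unfolding seminorm_cauchy_def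
proof (intro allI impI)
  fix e :: real assume "e > 0"
  then have "e / 2 > 0" by simp
  then obtain N N' where N: "\<And>m n. m \<ge> N \<Longrightarrow> n \<ge> N \<Longrightarrow> seminorm (X m - X n) < e / 2"
    and N': "\<And>m n. m \<ge> N' \<Longrightarrow> n \<ge> N' \<Longrightarrow> seminorm (Y m - Y n) < e / 2"
    using assms unfolding seminorm_cauchy_def by meson
  have "seminorm (X m + Y m - (X n + Y n)) < e" if "m \<ge> max N N'" "n \<ge> max N N'" for m n
    using N[of m n] N'[of m n] that seminorm_triangle[of "X m - X n" "Y m - Y n"]
    by (simp add: algebra_simps)
  then show "\<exists>N. \<forall>m\<ge>N. \<forall>n\<ge>N. seminorm (X m + Y m - (X n + Y n)) < e" by blast
qed

lemma seminorm_cauchy_scaleR: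
  assumes "seminorm_cauchy X"
  shows "seminorm_cauchy (\<lambda>n. c *\<^sub>R X n)"
  unfolding seminorm_cauchy_def
proof (intro allI impI)
  fix e :: real assume "e > 0"
  then have "e / (\<bar>c\<bar> + 1) > 0" by simp
  then obtain N where N: "\<And>m n. m \<ge> N \<Longrightarrow> n \<ge> N \<Longrightarrow> seminorm (X m - X n) < e / (\<bar>c\<bar> + 1)"
    using assms unfolding seminorm_cauchy_def by meson
  have "seminorm (c *\<^sub>R X m - c *\<^sub>R X n) < e" if "m \<ge> N" "n \<ge> N" for m n
  proof -
    have "seminorm (c *\<^sub>R X m - c *\<^sub>R X n) = \<bar>c\<bar> * seminorm (X m - X n)"
      by (simp add: seminorm_scaleR flip: scaleR_diff_right)
    also have "\<dots> \<le> (\<bar>c\<bar> + 1) * seminorm (X m - X n)" by (intro mult_right_mono) auto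
    also have "\<dots> < e" using N[OF that] by (simp add: field_simps)
    finally show ?thesis .
  qed
  then show "\<exists>N. \<forall>m\<ge>N. \<forall>n\<ge>N. seminorm (c *\<^sub>R X m - c *\<^sub>R X n) < e" by blast
qed

lemma cauchy_equiv_add:
  assumes "cauchy_equiv X X'" "cauchy_equiv Y Y'"
  shows "cauchy_equiv (\<lambda>n. X n + Y n) (\<lambda>n. X' n + Y' n)"
proof -
  have "(\<lambda>n. seminorm (X n - X' n) + seminorm (Y n - Y' n)) \<longlonglongrightarrow> 0"
    using assms tendsto_add_zero unfolding cauchy_equiv_def by blast
  then have "(\<lambda>n. seminorm (X n + Y n - (X' n + Y' n))) \<longlonglongrightarrow> 0"
    by (rule Lim_null_comparison[rotated])
       (use seminorm_triangle in \<open>auto intro!: always_eventually simp: add_diff_add\<close>)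
  then show ?thesis using assms by (simp add: cauchy_equiv_def seminorm_cauchy_add)
qed

lemma cauchy_equiv_scaleR:
  assumes "cauchy_equiv X X'"
  shows "cauchy_equiv (\<lambda>n. c *\<^sub>R X n) (\<lambda>n. c *\<^sub>R X' n)"
proof -
  have "(\<lambda>n. \<bar>c\<bar> * seminorm (X n - X' n)) \<longlonglongrightarrow> 0"
    using assms tendsto_mult_right_zero unfolding cauchy_equiv_def by blast
  then show ?thesis using assms
    by (simp add: cauchy_equiv_def seminorm_cauchy_scaleR seminorm_scaleR flip: scaleR_diff_right)
qed

lemma cauchy_equiv_refl: "seminorm_cauchy X \<Longrightarrow> cauchy_equiv X X"
  by (simp add: cauchy_equiv_def)

lemma part_equivp_cauchy_equiv: "part_equivp cauchy_equiv"
proof (rule part_equivpI)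
  show "\<exists>X. cauchy_equiv X X" using cauchy_equiv_refl seminorm_cauchy_const by blast
  show "symp cauchy_equiv"
    by (auto intro!: sympI simp: cauchy_equiv_def seminorm_minus_commute)
  show "transp cauchy_equiv"
  proof (rule transpI)
    fix X Y Z assume XY: "cauchy_equiv X Y" and YZ: "cauchy_equiv Y Z"
    then have "(\<lambda>n. seminorm (X n - Y n) + seminorm (Y n - Z n)) \<longlonglongrightarrow> 0"
      using tendsto_add_zero unfolding cauchy_equiv_def by blast
    then have "(\<lambda>n. seminorm (X n - Z n)) \<longlonglongrightarrow> 0"
      by (rule Lim_null_comparison[rotated])
         (use seminorm_diff_triangle in \<open>auto intro!: always_eventually\<close>)
    then show "cauchy_equiv X Z" using XY YZ by (simp add: cauchy_equiv_def)
  qed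
qed

lemma seminorm_cauchy_LIMSEQ:
  assumes "seminorm_cauchy X"
  shows "(\<lambda>n. seminorm (X n)) \<longlonglongrightarrow> lim (\<lambda>n. seminorm (X n))"
proof -
  have "Cauchy (\<lambda>n. seminorm (X n))"
    using assms unfolding seminorm_cauchy_def Cauchy_def dist_real_def
    by (meson seminorm_diff_abs le_less_trans)
  then show ?thesis using Cauchy_convergent convergent_LIMSEQ_iff by blast
qed

lemma cauchy_equiv_lim_eq:
  assumes "cauchy_equiv X Y"
  shows "lim (\<lambda>n. seminorm (X n)) = lim (\<lambda>n. seminorm (Y n))"
proof -
  have "(\<lambda>n. seminorm (X n - Y n)) \<longlonglongrightarrow> 0" using assms by (simp add: cauchy_equiv_def)
  then have "(\<lambda>n. seminorm (X n) - seminorm (Y n)) \<longlonglongrightarrow> 0"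
    by (rule Lim_null_comparison[rotated])
       (use seminorm_diff_abs in \<open>auto intro!: always_eventually\<close>)
  moreover have "(\<lambda>n. seminorm (X n) - seminorm (Y n)) \<longlonglongrightarrow>
      lim (\<lambda>n. seminorm (X n)) - lim (\<lambda>n. seminorm (Y n))"
    using assms by (intro tendsto_diff seminorm_cauchy_LIMSEQ) (auto simp: cauchy_equiv_def)
  ultimately show ?thesis using LIMSEQ_unique by fastforce
qed

quotient_type (overloaded) 'a completion = "nat \<Rightarrow> 'a::seminormed_vector" / partial: cauchy_equiv
  by (rule part_equivp_cauchy_equiv)

instantiation completion :: (seminormed_vector) real_vector
begin

lift_definition zero_completion :: "'a completion" is "\<lambda>_. 0"
  by (rule cauchy_equiv_refl[OF seminorm_cauchy_const])

lift_definition plus_completion :: "'a completion \<Rightarrow> 'a completion \<Rightarrow> 'a completion"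
  is "\<lambda>X Y n. X n + Y n"
  by (rule cauchy_equiv_add)

lift_definition scaleR_completion :: "real \<Rightarrow> 'a completion \<Rightarrow> 'a completion"
  is "\<lambda>c X n. c *\<^sub>R X n"
  by (rule cauchy_equiv_scaleR)

definition uminus_completion :: "'a completion \<Rightarrow> 'a completion" where
  "uminus_completion x = (- 1) *\<^sub>R x"

definition minus_completion :: "'a completion \<Rightarrow> 'a completion \<Rightarrow> 'a completion" where
  "minus_completion x y = x + - y"

instance
proof
  fix x y z :: "'a completion" and a b :: real
  show "x + y + z = x + (y + z)"
    by transfer (simp add: add.assoc cauchy_equiv_refl cauchy_equiv_def seminorm_cauchy_add)
  show "x + y = y + x"
    by transfer (simp add: add.commute cauchy_equiv_def seminorm_cauchy_add)
  show "0 + x = x"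
    by transfer (simp add: cauchy_equiv_def)
  show "- x + x = 0"
    unfolding uminus_completion_def
    by transfer (simp add: cauchy_equiv_def seminorm_cauchy_const)
  show "x - y = x + - y"
    by (simp add: minus_completion_def)
  show "a *\<^sub>R (x + y) = a *\<^sub>R x + a *\<^sub>R y"
    by transfer (simp add: cauchy_equiv_def scaleR_add_right seminorm_cauchy_add seminorm_cauchy_scaleR)
  show "(a + b) *\<^sub>R x = a *\<^sub>R x + b *\<^sub>R x"
    by transfer (simp add: cauchy_equiv_def scaleR_add_left seminorm_cauchy_add seminorm_cauchy_scaleR)
  show "a *\<^sub>R b *\<^sub>R x = (a * b) *\<^sub>R x"
    by transfer (simp add: cauchy_equiv_def seminorm_cauchy_scaleR)
  show "1 *\<^sub>R x = x"
    by transfer (simp add: cauchy_equiv_def)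
qed

end

instantiation completion :: (seminormed_vector) real_normed_vector
begin

lift_definition norm_completion :: "'a completion \<Rightarrow> real" is "\<lambda>X. lim (\<lambda>n. seminorm (X n))"
  by (rule cauchy_equiv_lim_eq)

definition dist_completion :: "'a completion \<Rightarrow> 'a completion \<Rightarrow> real" where
  "dist_completion x y = norm (x - y)"

definition sgn_completion :: "'a completion \<Rightarrow> 'a completion" where
  "sgn_completion x = x /\<^sub>R norm x"

definition uniformity_completion :: "('a completion \<times> 'a completion) filter" where
  "uniformity_completion = (INF e\<in>{0<..}. principal {(x, y). dist x y < e})"

definition open_completion :: "'a completion set \<Rightarrow> bool" where
  "open_completion U \<longleftrightarrow> (\<forall>x\<in>U. eventually (\<lambda>(x', y). x' = x \<longrightarrow> y \<in> U) uniformity)"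

instance
proof
  fix x y :: "'a completion" and c :: real
  show "norm x = 0 \<longleftrightarrow> x = 0"
  proof transfer
    fix X :: "nat \<Rightarrow> 'a" assume "cauchy_equiv X X"
    then have X: "seminorm_cauchy X" by (simp add: cauchy_equiv_def)
    show "lim (\<lambda>n. seminorm (X n)) = 0 \<longleftrightarrow> cauchy_equiv X (\<lambda>_. 0)"
      using seminorm_cauchy_LIMSEQ[OF X] limI[of "\<lambda>n. seminorm (X n)" 0] X
      by (auto simp: cauchy_equiv_def seminorm_cauchy_const)
  qed
  show "norm (x + y) \<le> norm x + norm y"
  proof transfer
    fix X Y :: "nat \<Rightarrow> 'a" assume "cauchy_equiv X X" "cauchy_equiv Y Y"
    then have XY: "seminorm_cauchy X" "seminorm_cauchy Y" by (simp_all add: cauchy_equiv_def)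
    show "lim (\<lambda>n. seminorm (X n + Y n)) \<le> lim (\<lambda>n. seminorm (X n)) + lim (\<lambda>n. seminorm (Y n))"
      by (rule LIMSEQ_le[OF seminorm_cauchy_LIMSEQ[OF seminorm_cauchy_add[OF XY]]
            tendsto_add[OF XY[THEN seminorm_cauchy_LIMSEQ]]])
         (use seminorm_triangle in blast)
  qed
  show "norm (c *\<^sub>R x) = \<bar>c\<bar> * norm x"
  proof transfer
    fix c and X :: "nat \<Rightarrow> 'a" assume "cauchy_equiv X X"
    then have X: "seminorm_cauchy X" by (simp add: cauchy_equiv_def)
    show "lim (\<lambda>n. seminorm (c *\<^sub>R X n)) = \<bar>c\<bar> * lim (\<lambda>n. seminorm (X n))"
      unfolding seminorm_scaleR by (intro limI tendsto_mult_left seminorm_cauchy_LIMSEQ X)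
  qed
qed (simp_all add: dist_completion_def sgn_completion_def uniformity_completion_def open_completion_def)

end

lift_definition to_completion :: "'a::seminormed_vector \<Rightarrow> 'a completion" is "\<lambda>x _. x"
  by (rule cauchy_equiv_refl[OF seminorm_cauchy_const])

lemma linear_to_completion: "linear to_completion"
  by (rule linearI; transfer) (simp_all add: cauchy_equiv_refl seminorm_cauchy_const)

lemma norm_to_completion: "norm (to_completion x) = seminorm x"
  by transfer (simp add: limI)

lemma to_completion_diff: "to_completion (x - y) = to_completion x - to_completion y"
  by (rule linear_diff[OF linear_to_completion])

lemma norm_diff_to_completion:
  assumes "seminorm_cauchy X"
  shows "(\<lambda>n. norm (abs_completion X - to_completion (X n))) \<longlonglongrightarrow> 0"
proof (rule LIMSEQ_I)
  fix e :: real assume e: "e > 0"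
  then have "e / 2 > 0" by simp
  then obtain N where N: "\<And>m n. m \<ge> N \<Longrightarrow> n \<ge> N \<Longrightarrow> seminorm (X m - X n) < e / 2"
    using assms unfolding seminorm_cauchy_def by meson
  have "norm (abs_completion X - to_completion (X n)) < e" if n: "n \<ge> N" for n
  proof -
    have X: "cauchy_equiv X X" using assms by (rule cauchy_equiv_refl)
    have c: "seminorm_cauchy (\<lambda>m. X m + - 1 *\<^sub>R X n)"
      by (intro seminorm_cauchy_add assms seminorm_cauchy_const)
    have "abs_completion X - to_completion (X n) = abs_completion (\<lambda>m. X m + - 1 *\<^sub>R X n)"
      unfolding minus_completion_def uminus_completion_def to_completion_def
      by (simp only: plus_completion.abs_eq scaleR_completion.abs_eq X map_fun_apply id_apply
          cauchy_equiv_refl seminorm_cauchy_const)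
    then have "norm (abs_completion X - to_completion (X n)) = lim (\<lambda>m. seminorm (X m - X n))"
      by (simp add: norm_completion.abs_eq cauchy_equiv_refl c[simplified])
    also have "\<dots> \<le> e / 2"
      using seminorm_cauchy_LIMSEQ[OF c] N n
      by (intro LIMSEQ_le_const2[of "\<lambda>m. seminorm (X m - X n)"]) (auto intro!: exI[of _ N] less_imp_le)
    finally show ?thesis using e by simp
  qed
  then show "\<exists>N. \<forall>n\<ge>N. norm (norm (abs_completion X - to_completion (X n)) - 0) < e" by auto
qed

lemma to_completion_dense:
  assumes "e > 0"
  shows "\<exists>x. norm (c - to_completion x) < e"
proof (induct c)
  case (1 X)
  then have "(\<lambda>n. norm (abs_completion X - to_completion (X n))) \<longlonglongrightarrow> 0"
    by (intro norm_diff_to_completion) (simp add: cauchy_equiv_def)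
  from order_tendstoD(2)[OF this assms] show ?case
    by (auto simp: eventually_sequentially)
qed

instance completion :: (seminormed_vector) banach
proof
  fix S :: "nat \<Rightarrow> 'a completion"
  assume S: "Cauchy S"
  have "\<exists>x. norm (S n - to_completion x) < inverse (real (Suc n))" for n
    by (rule to_completion_dense) simp
  then obtain X where X: "\<And>n. norm (S n - to_completion (X n)) < inverse (real (Suc n))" by metis
  have close: "(\<lambda>n. S n - to_completion (X n)) \<longlonglongrightarrow> 0"
    by (rule Lim_null_comparison[OF _ LIMSEQ_inverse_real_of_nat])
       (use X in \<open>auto intro!: always_eventually less_imp_le\<close>)
  have "seminorm_cauchy X"
    unfolding seminorm_cauchy_def
  proof (intro allI impI)
    fix e :: real assume "e > 0"
    then have e: "e / 3 > 0" by simp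
    obtain N where N: "\<And>m n. m \<ge> N \<Longrightarrow> n \<ge> N \<Longrightarrow> norm (S m - S n) < e / 3"
      using S e unfolding Cauchy_def dist_norm by blast
    obtain N' where N': "\<And>n. n \<ge> N' \<Longrightarrow> norm (S n - to_completion (X n)) < e / 3"
      using LIMSEQ_D[OF close e] by auto
    have "seminorm (X m - X n) < e" if mn: "m \<ge> max N N'" "n \<ge> max N N'" for m n
    proof -
      have "seminorm (X m - X n) = norm ((S m - S n) - (S m - to_completion (X m)) +
          (S n - to_completion (X n)))"
        by (simp add: to_completion_diff flip: norm_to_completion)
      also have "\<dots> \<le> norm (S m - S n) + norm (S m - to_completion (X m)) +
          norm (S n - to_completion (X n))"
        by (rule order_trans[OF norm_triangle_ineq add_right_mono[OF norm_triangle_ineq4]])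
      also have "\<dots> < e" using N[of m n] N'[of m] N'[of n] mn by simp
      finally show ?thesis .
    qed
    then show "\<exists>N. \<forall>m\<ge>N. \<forall>n\<ge>N. seminorm (X m - X n) < e" by blast
  qed
  then have "(\<lambda>n. norm (to_completion (X n) - abs_completion X)) \<longlonglongrightarrow> 0"
    using norm_diff_to_completion by (subst norm_minus_commute)
  then have "(\<lambda>n. to_completion (X n)) \<longlonglongrightarrow> abs_completion X"
    by (rule LIM_zero_cancel[OF tendsto_norm_zero_cancel])
  then have "(\<lambda>n. (S n - to_completion (X n)) + to_completion (X n)) \<longlonglongrightarrow> 0 + abs_completion X"
    using close by (intro tendsto_add)
  then show "convergent S" by (auto simp: convergent_def)
qed


section \<open>Tensor powers\<close>

text \<open>The index type \<open>'l\<close> has \<open>\<ell>\<close> elements; an \<open>\<ell>\<close>-tuple is a function on \<open>'l\<close>.\<close>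

typedef (overloaded) ('a::real_vector, 'l::finite) multilinear_form =
  "{\<phi> :: ('l \<Rightarrow> 'a) \<Rightarrow> real. \<forall>i x. linear (\<lambda>a. \<phi> (x(i := a)))}"
  morphisms mform_apply Abs_multilinear_form
  by (rule exI[of _ "\<lambda>_. 0"]) (simp add: linear_zero)

text \<open>The algebraic tensor power is realised as the span of the elementary tensors
  \<open>\<phi> \<mapsto> \<phi> (x\<^sub>1, \<dots>, x\<^sub>\<ell>)\<close> in the algebraic dual of the space of multilinear forms.  Scalar
  coefficients can be absorbed into the factors, so finite sums of elementary tensors suffice.\<close>

definition tensor_sum :: "('l \<Rightarrow> 'a) list \<Rightarrow> ('a::real_vector, 'l::finite) multilinear_form \<Rightarrow> real" where
  "tensor_sum xs = (\<lambda>\<phi>. \<Sum>x\<leftarrow>xs. mform_apply \<phi> x)"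

definition projective_seminorm ::
    "(('a::real_normed_vector, 'l::finite) multilinear_form \<Rightarrow> real) \<Rightarrow> real" where
  "projective_seminorm T = Inf {\<Sum>x\<leftarrow>xs. \<Prod>i\<in>UNIV. norm (x i) | xs. tensor_sum xs = T}"

definition product_form ::
    "('l::finite \<Rightarrow> 'a::real_normed_vector \<Rightarrow>\<^sub>L real) \<Rightarrow> ('a, 'l) multilinear_form" where
  "product_form f = Abs_multilinear_form (\<lambda>x. \<Prod>i\<in>UNIV. blinfun_apply (f i) (x i))"

text \<open>The value \<open>T (product_form f)\<close> is the value of \<open>f\<^sub>1 \<otimes> \<dots> \<otimes> f\<^sub>\<ell>\<close> at the tensor \<open>T\<close>.\<close>

definition injective_seminorm ::
    "(('a::real_normed_vector, 'l::finite) multilinear_form \<Rightarrow> real) \<Rightarrow> real" where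
  "injective_seminorm T = (SUP f\<in>{f. \<forall>i. norm (f i) \<le> 1}. \<bar>T (product_form f)\<bar>)"

lemma tensor_sum_Nil [simp]: "tensor_sum [] = (\<lambda>_. 0)"
  by (simp add: tensor_sum_def)

lemma tensor_sum_append: "tensor_sum (xs @ ys) = (\<lambda>\<phi>. tensor_sum xs \<phi> + tensor_sum ys \<phi>)"
  by (simp add: tensor_sum_def)

lemma linear_mform_apply: "linear (\<lambda>a. mform_apply \<phi> (x(i := a)))"
  using mform_apply[of \<phi>] by blast

lemma mform_apply_scaleR: "mform_apply \<phi> (x(i := c *\<^sub>R x i)) = c * mform_apply \<phi> x"
  using linear_scale[OF linear_mform_apply, of \<phi> x i c "x i"] by simp

lemma tensor_sum_scale:
  "tensor_sum (map (\<lambda>x. x(i := c *\<^sub>R x i)) xs) = (\<lambda>\<phi>. c * tensor_sum xs \<phi>)"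
  by (rule ext, induct xs) (simp_all add: tensor_sum_def mform_apply_scaleR algebra_simps)

lemma mform_apply_product_form:
  "mform_apply (product_form f) x = (\<Prod>i\<in>UNIV. blinfun_apply (f i) (x i))"
proof -
  have "linear (\<lambda>a. \<Prod>j\<in>UNIV. blinfun_apply (f j) ((x(i := a)) j))" for i x
  proof -
    have "(\<lambda>a. \<Prod>j\<in>UNIV. blinfun_apply (f j) ((x(i := a)) j)) =
        (\<lambda>a. (\<Prod>j\<in>UNIV - {i}. blinfun_apply (f j) (x j)) *\<^sub>R blinfun_apply (f i) a)"
      by (rule ext) (subst prod.remove[of _ i], simp_all add: mult.commute)
    then show ?thesis
      by (simp add: linear_iff blinfun.add_right blinfun.scaleR_right algebra_simps)
  qed
  then show ?thesis by (simp add: product_form_def Abs_multilinear_form_inverse)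
qed

definition algebraic_tensors :: "(('a::real_vector, 'l::finite) multilinear_form \<Rightarrow> real) set" where
  "algebraic_tensors = range tensor_sum"

lemma algebraic_tensors_zero: "(\<lambda>_. 0) \<in> algebraic_tensors"
  unfolding algebraic_tensors_def by (rule range_eqI[of _ _ "[]"]) simp

lemma algebraic_tensors_add:
  "S \<in> algebraic_tensors \<Longrightarrow> T \<in> algebraic_tensors \<Longrightarrow> (\<lambda>\<phi>. S \<phi> + T \<phi>) \<in> algebraic_tensors"
  unfolding algebraic_tensors_def by (auto simp flip: tensor_sum_append)

lemma algebraic_tensors_scale:
  "T \<in> algebraic_tensors \<Longrightarrow> (\<lambda>\<phi>. c * T \<phi>) \<in> algebraic_tensors"
  unfolding algebraic_tensors_def by (auto simp flip: tensor_sum_scale[of undefined])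

lemma algebraic_tensors_minus:
  "T \<in> algebraic_tensors \<Longrightarrow> (\<lambda>\<phi>. - T \<phi>) \<in> algebraic_tensors"
  using algebraic_tensors_scale[of T "- 1"] by simp

lemma algebraic_tensors_diff:
  "S \<in> algebraic_tensors \<Longrightarrow> T \<in> algebraic_tensors \<Longrightarrow> (\<lambda>\<phi>. S \<phi> - T \<phi>) \<in> algebraic_tensors"
  using algebraic_tensors_add[of S "\<lambda>\<phi>. - T \<phi>"] algebraic_tensors_minus[of T] by simp

lemma sum_list_prod_norm_nonneg: "0 \<le> (\<Sum>x\<leftarrow>xs. \<Prod>i\<in>UNIV. norm (x i))"
  by (induct xs) (simp_all add: prod_nonneg)

lemma projective_seminorm_le: "projective_seminorm (tensor_sum xs) \<le> (\<Sum>x\<leftarrow>xs. \<Prod>i\<in>UNIV. norm (x i))"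
  unfolding projective_seminorm_def
  by (rule cInf_lower) (auto intro!: bdd_belowI[of _ 0] sum_list_prod_norm_nonneg)

lemma projective_seminorm_approx:
  assumes "T \<in> algebraic_tensors" "e > 0"
  shows "\<exists>xs. tensor_sum xs = T \<and> (\<Sum>x\<leftarrow>xs. \<Prod>i\<in>UNIV. norm (x i)) < projective_seminorm T + e"
proof -
  let ?S = "{\<Sum>x\<leftarrow>xs. \<Prod>i\<in>UNIV. norm (x i) | xs. tensor_sum xs = T}"
  have "?S \<noteq> {}" using assms(1) by (auto simp: algebraic_tensors_def)
  moreover have "Inf ?S < projective_seminorm T + e"
    using assms(2) by (simp add: projective_seminorm_def)
  ultimately obtain y where "y \<in> ?S" "y < projective_seminorm T + e"
    using cInf_lessD[of ?S] by blast
  then show ?thesis by blast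
qed

lemma projective_seminorm_triangle:
  assumes S: "S \<in> algebraic_tensors" and T: "T \<in> algebraic_tensors"
  shows "projective_seminorm (\<lambda>\<phi>. S \<phi> + T \<phi>) \<le> projective_seminorm S + projective_seminorm T"
proof (rule field_le_epsilon)
  fix e :: real assume "e > 0"
  then have "e / 2 > 0" by simp
  from projective_seminorm_approx[OF S this] projective_seminorm_approx[OF T this]
  obtain xs ys where xs: "tensor_sum xs = S" "(\<Sum>x\<leftarrow>xs. \<Prod>i\<in>UNIV. norm (x i)) < projective_seminorm S + e / 2"
    and ys: "tensor_sum ys = T" "(\<Sum>x\<leftarrow>ys. \<Prod>i\<in>UNIV. norm (x i)) < projective_seminorm T + e / 2"
    by blast
  then show "projective_seminorm (\<lambda>\<phi>. S \<phi> + T \<phi>) \<le> projective_seminorm S + projective_seminorm T + e"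
    using projective_seminorm_le[of "xs @ ys"] by (simp add: tensor_sum_append)
qed

lemma projective_seminorm_scale_le:
  fixes T :: "('a::real_normed_vector, 'l::finite) multilinear_form \<Rightarrow> real"
  assumes "T \<in> algebraic_tensors"
  shows "projective_seminorm (\<lambda>\<phi>. c * T \<phi>) \<le> \<bar>c\<bar> * projective_seminorm T"
proof (rule field_le_epsilon)
  fix e :: real assume e: "e > 0"
  then have "e / (\<bar>c\<bar> + 1) > 0" by simp
  from projective_seminorm_approx[OF assms this]
  obtain xs where xs: "tensor_sum xs = T"
    "(\<Sum>x\<leftarrow>xs. \<Prod>i\<in>UNIV. norm (x i)) < projective_seminorm T + e / (\<bar>c\<bar> + 1)" by blast
  let ?i = "undefined :: 'l"
  have "(\<Prod>j\<in>UNIV. norm ((x(?i := c *\<^sub>R x ?i)) j)) = \<bar>c\<bar> * (\<Prod>j\<in>UNIV. norm (x j))" for x :: "'l \<Rightarrow> 'a"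
    by (subst (1 2) prod.remove[of _ ?i]) simp_all
  then have "(\<Sum>x\<leftarrow>map (\<lambda>x. x(?i := c *\<^sub>R x ?i)) xs. \<Prod>j\<in>UNIV. norm (x j)) =
      \<bar>c\<bar> * (\<Sum>x\<leftarrow>xs. \<Prod>j\<in>UNIV. norm (x j))"
    by (simp add: o_def sum_list_const_mult del: fun_upd_apply)
  then have "projective_seminorm (\<lambda>\<phi>. c * T \<phi>) \<le> \<bar>c\<bar> * (\<Sum>x\<leftarrow>xs. \<Prod>j\<in>UNIV. norm (x j))"
    using projective_seminorm_le[of "map (\<lambda>x. x(?i := c *\<^sub>R x ?i)) xs"] xs(1)
    by (simp add: tensor_sum_scale del: fun_upd_apply)
  also have "\<dots> \<le> \<bar>c\<bar> * (projective_seminorm T + e / (\<bar>c\<bar> + 1))"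
    using xs(2) by (intro mult_left_mono) auto
  also have "\<dots> \<le> \<bar>c\<bar> * projective_seminorm T + e"
    using e by (simp add: field_simps)
  finally show "projective_seminorm (\<lambda>\<phi>. c * T \<phi>) \<le> \<bar>c\<bar> * projective_seminorm T + e" .
qed

lemma projective_seminorm_scale:
  fixes T :: "('a::real_normed_vector, 'b::finite) multilinear_form \<Rightarrow> real"
  assumes "T \<in> algebraic_tensors"
  shows "projective_seminorm (\<lambda>\<phi>. c * T \<phi>) = \<bar>c\<bar> * projective_seminorm T"
proof (cases "c = 0")
  case True
  have "0 \<le> projective_seminorm ((\<lambda>_. 0) :: ('a, 'b) multilinear_form \<Rightarrow> real)"
    unfolding projective_seminorm_def
    by (rule cInf_greatest) (auto intro: exI[of _ "[]"] sum_list_prod_norm_nonneg)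
  moreover have "projective_seminorm ((\<lambda>_. 0) :: ('a, 'b) multilinear_form \<Rightarrow> real) \<le> 0"
    using projective_seminorm_le[of "[]"] by simp
  ultimately have "projective_seminorm ((\<lambda>_. 0) :: ('a, 'b) multilinear_form \<Rightarrow> real) = 0"
    by (rule antisym[rotated])
  then show ?thesis using True by simp
next
  case False
  have "projective_seminorm T \<le> \<bar>inverse c\<bar> * projective_seminorm (\<lambda>\<phi>. c * T \<phi>)"
    using projective_seminorm_scale_le[OF algebraic_tensors_scale[OF assms, of c], of "inverse c"] False
    by (simp flip: mult.assoc)
  then show ?thesis using projective_seminorm_scale_le[OF assms, of c] False by (simp add: field_simps)
qed

lemma injective_seminorm_bdd:
  assumes "T \<in> algebraic_tensors"
  shows "bdd_above ((\<lambda>f. \<bar>T (product_form f)\<bar>) ` {f. \<forall>i. norm (f i) \<le> 1})"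
proof -
  obtain xs where T: "T = tensor_sum xs" using assms by (auto simp: algebraic_tensors_def)
  have "\<bar>tensor_sum xs (product_form f)\<bar> \<le> (\<Sum>x\<leftarrow>xs. \<Prod>i\<in>UNIV. norm (x i))"
    if f: "\<forall>i. norm (f i) \<le> 1" for f
  proof (induct xs)
    case (Cons x xs)
    have "norm (blinfun_apply (f i) (x i)) \<le> norm (x i)" for i
      using norm_blinfun[of "f i" "x i"] f mult_right_mono[of "norm (f i)" 1 "norm (x i)"] by simp
    then have "\<bar>\<Prod>i\<in>UNIV. blinfun_apply (f i) (x i)\<bar> \<le> (\<Prod>i\<in>UNIV. norm (x i))"
      unfolding abs_prod by (intro prod_mono) auto
    then show ?case using Cons by (simp add: tensor_sum_def mform_apply_product_form)
  qed simp
  then show ?thesis unfolding T by (intro bdd_aboveI2) blast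
qed

lemma injective_seminorm_triangle:
  assumes "S \<in> algebraic_tensors" "T \<in> algebraic_tensors"
  shows "injective_seminorm (\<lambda>\<phi>. S \<phi> + T \<phi>) \<le> injective_seminorm S + injective_seminorm T"
  unfolding injective_seminorm_def
proof (rule cSUP_least)
  show "{f :: 'b \<Rightarrow> 'a \<Rightarrow>\<^sub>L real. \<forall>i. norm (f i) \<le> 1} \<noteq> {}" by (auto intro!: exI[of _ "\<lambda>_. 0"])
  fix f :: "'b \<Rightarrow> 'a \<Rightarrow>\<^sub>L real" assume "f \<in> {f. \<forall>i. norm (f i) \<le> 1}"
  then show "\<bar>S (product_form f) + T (product_form f)\<bar> \<le>
      (SUP f\<in>{f. \<forall>i. norm (f i) \<le> 1}. \<bar>S (product_form f)\<bar>) +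
      (SUP f\<in>{f. \<forall>i. norm (f i) \<le> 1}. \<bar>T (product_form f)\<bar>)"
    using assms[THEN injective_seminorm_bdd]
    by (intro order_trans[OF abs_triangle_ineq] add_mono cSUP_upper)
qed

lemma injective_seminorm_scale:
  assumes "T \<in> algebraic_tensors"
  shows "injective_seminorm (\<lambda>\<phi>. c * T \<phi>) = \<bar>c\<bar> * injective_seminorm T"
proof -
  have ne: "{f :: 'b \<Rightarrow> 'a \<Rightarrow>\<^sub>L real. \<forall>i. norm (f i) \<le> 1} \<noteq> {}" by (auto intro!: exI[of _ "\<lambda>_. 0"])
  have "\<bar>c\<bar> * injective_seminorm T =
      (SUP y\<in>(\<lambda>f. \<bar>T (product_form f)\<bar>) ` {f. \<forall>i. norm (f i) \<le> 1}. \<bar>c\<bar> * y)"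
    unfolding injective_seminorm_def
    by (rule continuous_at_Sup_mono)
       (use ne injective_seminorm_bdd[OF assms] in \<open>auto intro!: monoI mult_left_mono continuous_intros\<close>)
  then show ?thesis by (simp add: injective_seminorm_def image_comp o_def abs_mult)
qed

text \<open>Two copies of the algebraic tensor power, carrying the projective and the injective norm.  Both
  seminorms are in fact norms, so \<^typ>\<open>'a completion\<close> makes no identification in the algebraic
  tensor power.\<close>

typedef (overloaded) ('a::real_vector, 'l::finite) projective_alg =
  "algebraic_tensors :: (('a, 'l) multilinear_form \<Rightarrow> real) set"
  using algebraic_tensors_zero by blast

typedef (overloaded) ('a::real_vector, 'l::finite) injective_alg =
  "algebraic_tensors :: (('a, 'l) multilinear_form \<Rightarrow> real) set"
  using algebraic_tensors_zero by blast

setup_lifting type_definition_projective_alg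
setup_lifting type_definition_injective_alg

instantiation projective_alg :: (real_normed_vector, finite) seminormed_vector
begin

lift_definition zero_projective_alg :: "('a, 'b) projective_alg" is "\<lambda>_. 0"
  by (rule algebraic_tensors_zero)

lift_definition plus_projective_alg ::
  "('a, 'b) projective_alg \<Rightarrow> ('a, 'b) projective_alg \<Rightarrow> ('a, 'b) projective_alg"
  is "\<lambda>S T \<phi>. S \<phi> + T \<phi>"
  by (rule algebraic_tensors_add)

lift_definition minus_projective_alg ::
  "('a, 'b) projective_alg \<Rightarrow> ('a, 'b) projective_alg \<Rightarrow> ('a, 'b) projective_alg"
  is "\<lambda>S T \<phi>. S \<phi> - T \<phi>"
  by (rule algebraic_tensors_diff)

lift_definition uminus_projective_alg :: "('a, 'b) projective_alg \<Rightarrow> ('a, 'b) projective_alg"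
  is "\<lambda>T \<phi>. - T \<phi>"
  by (rule algebraic_tensors_minus)

lift_definition scaleR_projective_alg :: "real \<Rightarrow> ('a, 'b) projective_alg \<Rightarrow> ('a, 'b) projective_alg"
  is "\<lambda>c T \<phi>. c * T \<phi>"
  by (rule algebraic_tensors_scale)

lift_definition seminorm_projective_alg :: "('a, 'b) projective_alg \<Rightarrow> real" is projective_seminorm .

instance
  by standard
     (transfer; simp add: fun_eq_iff algebra_simps projective_seminorm_triangle projective_seminorm_scale)+

end

instantiation injective_alg :: (real_normed_vector, finite) seminormed_vector
begin

lift_definition zero_injective_alg :: "('a, 'b) injective_alg" is "\<lambda>_. 0"
  by (rule algebraic_tensors_zero)

lift_definition plus_injective_alg ::
  "('a, 'b) injective_alg \<Rightarrow> ('a, 'b) injective_alg \<Rightarrow> ('a, 'b) injective_alg"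
  is "\<lambda>S T \<phi>. S \<phi> + T \<phi>"
  by (rule algebraic_tensors_add)

lift_definition minus_injective_alg ::
  "('a, 'b) injective_alg \<Rightarrow> ('a, 'b) injective_alg \<Rightarrow> ('a, 'b) injective_alg"
  is "\<lambda>S T \<phi>. S \<phi> - T \<phi>"
  by (rule algebraic_tensors_diff)

lift_definition uminus_injective_alg :: "('a, 'b) injective_alg \<Rightarrow> ('a, 'b) injective_alg"
  is "\<lambda>T \<phi>. - T \<phi>"
  by (rule algebraic_tensors_minus)

lift_definition scaleR_injective_alg :: "real \<Rightarrow> ('a, 'b) injective_alg \<Rightarrow> ('a, 'b) injective_alg"
  is "\<lambda>c T \<phi>. c * T \<phi>"
  by (rule algebraic_tensors_scale)

lift_definition seminorm_injective_alg :: "('a, 'b) injective_alg \<Rightarrow> real" is injective_seminorm .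

instance
  by standard
     (transfer; simp add: fun_eq_iff algebra_simps injective_seminorm_triangle injective_seminorm_scale)+

end

type_synonym ('a, 'l) projective_tensor_power = "('a, 'l) projective_alg completion"
type_synonym ('a, 'l) injective_tensor_power = "('a, 'l) injective_alg completion"

definition projective_power :: "'a::real_normed_vector \<Rightarrow> ('a, 'l::finite) projective_tensor_power" where
  "projective_power x = to_completion (Abs_projective_alg (tensor_sum [\<lambda>_. x]))"

definition injective_power :: "'a::real_normed_vector \<Rightarrow> ('a, 'l::finite) injective_tensor_power" where
  "injective_power x = to_completion (Abs_injective_alg (tensor_sum [\<lambda>_. x]))"


section \<open>Bochner integrability\<close>

text \<open>The library's \<^const>\<open>integrable\<close> is restricted to second countable spaces, which the tensor
  powers of \<open>D([0,1]\<^sup>m)\<close> are not.  Measurability of the norm of \<open>f\<close> modulo null sets follows from the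
  first conjunct.\<close>

definition Bochner_integrable :: "'w measure \<Rightarrow> ('w \<Rightarrow> 'b::real_normed_vector) \<Rightarrow> bool" where
  "Bochner_integrable M f \<longleftrightarrow>
     (\<exists>s :: nat \<Rightarrow> 'w \<Rightarrow> 'b. (\<forall>n. simple_function M (s n)) \<and> (AE w in M. (\<lambda>n. s n w) \<longlonglongrightarrow> f w)) \<and>
     (\<integral>\<^sup>+w. ennreal (norm (f w)) \<partial>M) < \<infinity>"

end

theory Submission
  imports Defs
begin

text \<open>
  If \<open>X\<close> has a Bochner integrable tensor power, the simple functions converging to it take countably
  many values, each of which is a limit of algebraic tensors; hence only countably many functions
  \<open>g \<in> D([0,1]\<^sup>m)\<close> enter.  Each \<open>g\<close> has nonzero jumps \<open>\<Delta>\<^sub>i g(t)\<close> only for countably many values of \<open>t\<^sub>i\<close>.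
  For every other \<open>t\<^sub>i\<close> the product functional \<open>\<Delta>\<^sub>i(t) \<otimes> \<dots> \<otimes> \<Delta>\<^sub>i(t)\<close> kills all approximants, hence also
  the power of \<open>X\<close>, on which its value is the \<open>\<ell>\<close>-th power of \<open>\<Delta>\<^sub>i X(t)\<close>.  The moment bound follows from
  \<open>\<parallel>x\<parallel>\<^sup>\<ell> = \<parallel>x \<otimes> \<dots> \<otimes> x\<parallel>\<close>.

  Conversely, if the jumps of \<open>X\<close> in direction \<open>i\<close> lie in a fixed countable set \<open>A\<^sub>i\<close>, rounding \<open>t\<close> down to
  finite grids that exhaust the \<open>A\<^sub>i\<close> approximates \<open>X\<close> uniformly.  After rounding also the values, one
  obtains simple functions converging to \<open>X\<close> in norm, and \<open>x \<mapsto> x \<otimes> \<dots> \<otimes> x\<close> is continuous.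
\<close>

section \<open>Octant limits and jumps\<close>

text \<open>As \<open>x\<close> increases to \<open>t $ i\<close> this is the curve along which
  \<open>jump i\<close> takes its left limit.\<close>

definition set_coord :: "'m::finite \<Rightarrow> real \<Rightarrow> real ^ 'm \<Rightarrow> real ^ 'm" where
  "set_coord i x t = (\<chi> j. if j = i then x else t $ j)"

lemma set_coord_nth [simp]: "set_coord i x t $ j = (if j = i then x else t $ j)"
  by (simp add: set_coord_def)

lemma tendsto_set_coord: "((\<lambda>x. set_coord i x t) \<longlongrightarrow> t) (at_left (t $ i))"
proof (rule vec_tendstoI)
  fix j
  show "((\<lambda>x. set_coord i x t $ j) \<longlongrightarrow> t $ j) (at_left (t $ i))"
    by (cases "j = i") auto
qed

lemma octant_iff:
  "s \<in> octant t L \<longleftrightarrow>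
    (\<forall>i. (i \<in> L \<longrightarrow> 0 \<le> s $ i \<and> s $ i < t $ i) \<and> (i \<notin> L \<longrightarrow> t $ i \<le> s $ i \<and> s $ i \<le> 1))"
  by (auto simp: octant_def)

lemma octant_subset_cbox:
  assumes "t \<in> cbox 0 1"
  shows "octant t L \<subseteq> cbox 0 1"
proof
  fix s assume s: "s \<in> octant t L"
  have "0 \<le> s $ i \<and> s $ i \<le> 1" for i
  proof -
    have "0 \<le> t $ i" "t $ i \<le> 1" using assms by (simp_all add: mem_box_cart)
    moreover have "i \<in> L \<longrightarrow> 0 \<le> s $ i \<and> s $ i < t $ i" "i \<notin> L \<longrightarrow> t $ i \<le> s $ i \<and> s $ i \<le> 1"
      using s by (simp_all add: octant_iff)
    ultimately show ?thesis by linarith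
  qed
  then show "s \<in> cbox 0 1" by (simp add: mem_box_cart)
qed

lemma in_octant: "s \<in> cbox 0 1 \<Longrightarrow> s \<in> octant t {i. s $ i < t $ i}"
  by (auto simp: octant_def mem_box_cart)

text \<open>If \<open>L\<close> contains a coordinate with \<open>t $ i = 0\<close>, the octant is
  empty and every number is a limit along the trivial filter. So limits can be chosen for all
  \<open>L\<close> without a positivity condition.\<close>

lemma octant_limits_exist:
  assumes f: "f \<in> skorokhod_functions" and t: "t \<in> cbox 0 1"
  obtains l where "\<And>L. (f \<longlongrightarrow> l L) (inf (nhds t) (principal (octant t L)))"
proof -
  have "\<exists>l. (f \<longlongrightarrow> l) (inf (nhds t) (principal (octant t L)))" for L
  proof (cases "\<forall>i\<in>L. 0 < t $ i")
    case True
    then show ?thesis using f t by (simp add: skorokhod_functions_def has_octant_limits_def)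
  next
    case False
    then obtain i where i: "i \<in> L" "t $ i \<le> 0" by (auto simp: not_less)
    then have "octant t L = {}" by (force simp: octant_def)
    then show ?thesis by simp
  qed
  then show ?thesis using that by metis
qed

text \<open>There are only finitely many octants at \<open>t\<close>, so one neighbourhood serves
  all of them.\<close>

lemma octant_limits_eventually:
  assumes l: "\<And>L. (f \<longlongrightarrow> l L) (inf (nhds t) (principal (octant t L)))" and e: "e > (0::real)"
  shows "\<forall>\<^sub>F s in nhds t. \<forall>L. s \<in> octant t L \<longrightarrow> \<bar>f s - l L\<bar> < e"
  by (rule eventually_all_finite)
     (use tendstoD[OF l e] in \<open>simp add: eventually_inf_principal dist_real_def\<close>)

text \<open>The curve stays in the octant of \<open>{i}\<close>, so the left limit exists and equals
  the octant limit there. Hence the \<open>Lim\<close> in \<open>jump\<close> is a genuine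
  limit.\<close>

lemma tendsto_jump:
  assumes t: "t \<in> cbox 0 1" and i: "0 < t $ i"
  shows "((\<lambda>x. skorokhod_apply f (set_coord i x t)) \<longlongrightarrow> skorokhod_apply f t - jump i f t)
    (at_left (t $ i))"
proof -
  obtain l where l: "\<And>L. (skorokhod_apply f \<longlongrightarrow> l L) (inf (nhds t) (principal (octant t L)))"
    using octant_limits_exist[OF skorokhod_apply t] by blast
  have "filterlim (\<lambda>x. set_coord i x t) (inf (nhds t) (principal (octant t {i}))) (at_left (t $ i))"
    unfolding filterlim_inf filterlim_principal
  proof
    show "\<forall>\<^sub>F x in at_left (t $ i). set_coord i x t \<in> octant t {i}"
      using eventually_at_left_field[of _ "t $ i"] i t
      by (auto simp: octant_def mem_box_cart intro!: eventually_at_leftI[of 0])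
  qed (rule tendsto_set_coord)
  from filterlim_compose[OF l this]
  have lim: "((\<lambda>x. skorokhod_apply f (set_coord i x t)) \<longlongrightarrow> l {i}) (at_left (t $ i))" .
  from tendsto_Lim[OF _ this] have "jump i f t = skorokhod_apply f t - l {i}"
    using i by (simp add: jump_def set_coord_def)
  then show ?thesis using lim by simp
qed

section \<open>Countability of the jump coordinates\<close>

text \<open>Near \<open>t\<close> a jump in direction \<open>i\<close> can exceed \<open>e\<close>
  only on the hyperplane through \<open>t\<close> orthogonal to that direction, since off it a point
  and its left neighbours share an octant at \<open>t\<close>. By compactness finitely many
  hyperplanes suffice.\<close>

lemma finite_large_jumps:
  fixes f :: "'m::finite skorokhod"
  assumes e: "e > 0"
  shows "finite ((\<lambda>t. t $ i) ` {t \<in> cbox 0 1. \<bar>jump i f t\<bar> > e})"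
proof -
  have "\<exists>U. open U \<and> t \<in> U \<and> (\<forall>s\<in>U \<inter> cbox 0 1. s $ i \<noteq> t $ i \<longrightarrow> \<bar>jump i f s\<bar> \<le> e)"
    if t: "t \<in> cbox 0 1" for t
  proof -
    obtain l where l: "\<And>L. (skorokhod_apply f \<longlongrightarrow> l L) (inf (nhds t) (principal (octant t L)))"
      using octant_limits_exist[OF skorokhod_apply t] by blast
    obtain U where U: "open U" "t \<in> U"
      "\<And>s L. s \<in> U \<Longrightarrow> s \<in> octant t L \<Longrightarrow> \<bar>skorokhod_apply f s - l L\<bar> < e / 2"
      using octant_limits_eventually[OF l half_gt_zero[OF e]] unfolding eventually_nhds by auto
    have "\<bar>jump i f s\<bar> \<le> e" if s: "s \<in> U" "s \<in> cbox 0 1" "s $ i \<noteq> t $ i" for s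
    proof (cases "0 < s $ i")
      case True
      let ?L = "{j. s $ j < t $ j}"
      have "\<forall>\<^sub>F x in at_left (s $ i). set_coord i x s \<in> U"
        using topological_tendstoD[OF tendsto_set_coord \<open>open U\<close> s(1)] .
      moreover have "\<forall>\<^sub>F x in at_left (s $ i). x < s $ i"
        by (rule eventually_at_leftI[of 0]) (use True in auto)
      moreover have "\<forall>\<^sub>F x in at_left (s $ i). x > 0"
        by (rule eventually_at_leftI[of 0]) (use True in auto)
      \<comment> \<open>Since \<open>s $ i\<close> differs from \<open>t $ i\<close>, a small move
        of \<open>s\<close> to the left does not cross \<open>t $ i\<close>, so the moved point
        stays in the octant \<open>?L\<close> of \<open>s\<close>.\<close>
      moreover have "\<forall>\<^sub>F x in at_left (s $ i). s $ i > t $ i \<longrightarrow> x > t $ i"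
        by (cases "s $ i > t $ i") (auto intro!: eventually_at_leftI[of "t $ i"])
      ultimately have "\<forall>\<^sub>F x in at_left (s $ i).
          \<bar>skorokhod_apply f s - skorokhod_apply f (set_coord i x s)\<bar> \<le> e"
      proof eventually_elim
        case (elim x)
        have "0 \<le> s $ j" "s $ j \<le> 1" for j using s(2) by (simp_all add: mem_box_cart)
        moreover have "s $ i < t $ i \<longrightarrow> x < t $ i" "\<not> s $ i < t $ i \<longrightarrow> t $ i \<le> x" "x \<le> 1"
          using elim s(3) calculation[of i] by linarith+
        ultimately have "set_coord i x s \<in> octant t ?L"
          using elim(3) by (simp add: octant_iff)
        from U(3)[OF elim(1) this] U(3)[OF s(1) in_octant[OF s(2)]] show ?case by linarith
      qed
      moreover have "((\<lambda>x. \<bar>skorokhod_apply f s - skorokhod_apply f (set_coord i x s)\<bar>) \<longlongrightarrow>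
          \<bar>skorokhod_apply f s - (skorokhod_apply f s - jump i f s)\<bar>) (at_left (s $ i))"
        by (intro tendsto_intros tendsto_jump s True)
      ultimately have "\<bar>skorokhod_apply f s - (skorokhod_apply f s - jump i f s)\<bar> \<le> e"
        by (intro tendsto_upperbound[where F = "at_left (s $ i)"]) simp_all
      then show ?thesis by simp
    next
      case False
      then show ?thesis using e by (simp add: jump_def)
    qed
    then show ?thesis using U by blast
  qed
  then obtain U where U: "\<And>t. t \<in> cbox 0 1 \<Longrightarrow> open (U t)" "\<And>t. t \<in> cbox 0 1 \<Longrightarrow> t \<in> U t"
    "\<And>t s. t \<in> cbox 0 1 \<Longrightarrow> s \<in> U t \<inter> cbox 0 1 \<Longrightarrow> s $ i \<noteq> t $ i \<Longrightarrow> \<bar>jump i f s\<bar> \<le> e"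
    by metis
  obtain C where C: "C \<subseteq> cbox 0 1" "finite C" "cbox 0 1 \<subseteq> (\<Union>t\<in>C. U t)"
    by (rule compactE_image[OF compact_cbox[of 0 "1 :: real ^ 'm"], of "cbox 0 1" U]) (use U in auto)
  have "(\<lambda>t. t $ i) ` {t \<in> cbox 0 1. \<bar>jump i f t\<bar> > e} \<subseteq> (\<lambda>t. t $ i) ` C"
  proof clarify
    fix s :: "real ^ 'm" assume s: "s \<in> cbox 0 1" "\<bar>jump i f s\<bar> > e"
    then obtain t where t: "t \<in> C" "s \<in> U t" using C by blast
    then have "s $ i = t $ i" using U(3)[of t s] s C(1) by force
    then show "s $ i \<in> (\<lambda>t. t $ i) ` C" using t by auto
  qed
  then show ?thesis using C(2) finite_surj by blast
qed

text \<open>Jumps can fill pieces of hyperplanes, so the set of points \<open>t\<close> itself may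
  be uncountable; only the \<open>i\<close>-th coordinates are recorded.\<close>

definition jump_coords :: "'m::finite \<Rightarrow> 'm skorokhod \<Rightarrow> real set" where
  "jump_coords i f = (\<lambda>t. t $ i) ` {t \<in> cbox 0 1. jump i f t \<noteq> 0}"

lemma jump_coords_subset: "jump_coords i f \<subseteq> {0..1}"
  by (auto simp: jump_coords_def mem_box_cart)

lemma countable_jump_coords: "countable (jump_coords i f)"
proof -
  have "jump_coords i f \<subseteq>
      (\<Union>n. (\<lambda>t. t $ i) ` {t \<in> cbox 0 1. \<bar>jump i f t\<bar> > inverse (real (Suc n))})"
  proof
    fix x assume "x \<in> jump_coords i f"
    then obtain t where t: "t \<in> cbox 0 1" "jump i f t \<noteq> 0" "x = t $ i" by (auto simp: jump_coords_def)
    then obtain n where "inverse (real (Suc n)) < \<bar>jump i f t\<bar>"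
      using reals_Archimedean[of "\<bar>jump i f t\<bar>"] by auto
    then show "x \<in> (\<Union>n. (\<lambda>t. t $ i) ` {t \<in> cbox 0 1. \<bar>jump i f t\<bar> > inverse (real (Suc n))})"
      using t by blast
  qed
  moreover have "countable (\<Union>n. (\<lambda>t. t $ i) ` {t \<in> cbox 0 1. \<bar>jump i f t\<bar> > inverse (real (Suc n))})"
    by (rule countable_UN) (auto intro!: countable_finite finite_large_jumps)
  ultimately show ?thesis by (rule countable_subset)
qed

section \<open>Equality of octant limits in directions without jumps\<close>

text \<open>Take a point near \<open>t\<close> in the octant of \<open>L\<close> with
  \<open>i\<close>-th coordinate exactly \<open>t $ i\<close>. Its value is close to
  \<open>l L\<close>, its left limit in direction \<open>i\<close> is close to
  \<open>l (insert i L)\<close>, and the two agree because there is no jump.\<close>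

lemma octant_limit_insert:
  fixes f :: "'m::finite skorokhod"
  assumes l: "\<And>L. (skorokhod_apply f \<longlongrightarrow> l L) (inf (nhds t) (principal (octant t L)))"
    and t: "t \<in> cbox 0 1" and pos: "\<forall>j\<in>insert i L. 0 < t $ j" and i: "i \<notin> L"
    and jump: "\<And>s. s \<in> cbox 0 1 \<Longrightarrow> s $ i = t $ i \<Longrightarrow> jump i f s = 0"
  shows "l (insert i L) = l L"
proof -
  have "\<bar>l (insert i L) - l L\<bar> \<le> e" if e: "e > 0" for e
  proof -
    obtain U where U: "open U" "t \<in> U"
      "\<And>s L. s \<in> U \<Longrightarrow> s \<in> octant t L \<Longrightarrow> \<bar>skorokhod_apply f s - l L\<bar> < e / 2"
      using octant_limits_eventually[OF l half_gt_zero[OF e]] unfolding eventually_nhds by auto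
    \<comment> \<open>For small \<open>r > 0\<close> this point lies strictly below \<open>t\<close>
      in the coordinates of \<open>L\<close>, which are positive at \<open>t\<close>, and agrees
      with \<open>t\<close> in all others, \<open>i\<close> included.\<close>
    define p where "p r = (\<chi> j. if j \<in> L then t $ j * (1 - r) else t $ j)" for r :: real
    have p: "(p \<longlongrightarrow> t) (at_right 0)"
    proof (rule vec_tendstoI)
      fix j
      have "((\<lambda>r. t $ j * (1 - r)) \<longlongrightarrow> t $ j * (1 - 0)) (at_right 0)" by (intro tendsto_intros)
      then show "((\<lambda>r. p r $ j) \<longlongrightarrow> t $ j) (at_right 0)" by (cases "j \<in> L") (simp_all add: p_def)
    qed
    have "\<forall>\<^sub>F r in at_right (0::real). p r \<in> U \<and> 0 < r \<and> r < 1"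
      by (intro eventually_conj topological_tendstoD[OF p U(1,2)] eventually_at_rightI[of 0 1]) auto
    then obtain r where r: "p r \<in> U" "0 < r" "r < 1"
      using eventually_happens[of _ "at_right (0::real)"] by auto
    have "0 \<le> t $ j * (1 - r) \<and> t $ j * (1 - r) < t $ j" if "j \<in> L" for j
      using r pos that by (simp add: right_diff_distrib)
    moreover have "t $ j \<le> 1" for j using t by (simp add: mem_box_cart)
    ultimately have oct: "p r \<in> octant t L" by (simp add: octant_iff p_def)
    then have box: "p r \<in> cbox 0 1" using octant_subset_cbox[OF t] by blast
    have pi: "p r $ i = t $ i" using i by (simp add: p_def)
    have "\<forall>\<^sub>F x in at_left (p r $ i). set_coord i x (p r) \<in> U \<and> 0 < x \<and> x < t $ i"
      using pos
      by (intro eventually_conj topological_tendstoD[OF tendsto_set_coord U(1) r(1)] eventually_at_leftI[of 0])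
         (auto simp: pi)
    then have "\<forall>\<^sub>F x in at_left (p r $ i).
        \<bar>skorokhod_apply f (set_coord i x (p r)) - l (insert i L)\<bar> \<le> e / 2"
    proof eventually_elim
      case (elim x)
      then have "set_coord i x (p r) \<in> octant t (insert i L)" using oct by (auto simp: octant_iff)
      from U(3)[OF _ this] elim show ?case by auto
    qed
    moreover have "((\<lambda>x. \<bar>skorokhod_apply f (set_coord i x (p r)) - l (insert i L)\<bar>) \<longlongrightarrow>
        \<bar>skorokhod_apply f (p r) - jump i f (p r) - l (insert i L)\<bar>) (at_left (p r $ i))"
      using pos by (intro tendsto_intros tendsto_jump box) (simp add: pi)
    ultimately have "\<bar>skorokhod_apply f (p r) - jump i f (p r) - l (insert i L)\<bar> \<le> e / 2"
      by (intro tendsto_upperbound[where F = "at_left (p r $ i)"]) simp_all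
    then show ?thesis using U(3)[OF r(1) oct] jump[OF box pi] by linarith
  qed
  from field_le_epsilon[of "\<bar>l (insert i L) - l L\<bar>" 0] this show ?thesis by auto
qed

text \<open>The hyperplanes in the directions of \<open>K\<close> are crossed one at a time.\<close>

lemma octant_limit_Un:
  fixes f :: "'m::finite skorokhod"
  assumes l: "\<And>L. (skorokhod_apply f \<longlongrightarrow> l L) (inf (nhds t) (principal (octant t L)))"
    and t: "t \<in> cbox 0 1" and pos: "\<forall>j\<in>L \<union> K. 0 < t $ j"
    and jump: "\<And>i s. i \<in> K \<Longrightarrow> s \<in> cbox 0 1 \<Longrightarrow> s $ i = t $ i \<Longrightarrow> jump i f s = 0"
  shows "l (L \<union> K) = l L"
proof -
  have "finite K" by simp
  then show ?thesis using pos jump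
  proof (induction K rule: finite_induct)
    case (insert i K)
    have "l (insert i (L \<union> K)) = l (L \<union> K)"
    proof (cases "i \<in> L")
      case True
      then show ?thesis by (simp add: insert_absorb)
    next
      case False
      then show ?thesis using insert by (intro octant_limit_insert[OF l t]) auto
    qed
    then show ?case using insert by auto
  qed simp
qed

section \<open>Jump and evaluation functionals\<close>

text \<open>Linearity comes from uniqueness of left limits. The constant 2 arises because a jump is
  the difference of a value and a limit of values, each bounded by the norm.\<close>

lemma bounded_linear_jump:
  assumes t: "t \<in> cbox 0 1"
  shows "bounded_linear (\<lambda>f. jump i f t)" and "\<bar>jump i f t\<bar> \<le> 2 * norm f"
proof -
  let ?F = "at_left (t $ i)"
  let ?a = "\<lambda>f x. skorokhod_apply f (set_coord i x t)"
  have jumpI: "jump i f t = skorokhod_apply f t - l" if "0 < t $ i" "(?a f \<longlongrightarrow> l) ?F" for f l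
    using tendsto_unique[OF _ tendsto_jump[OF t that(1), of f] that(2)] by simp
  have lin: "linear (\<lambda>f. jump i f t)"
  proof (cases "0 < t $ i")
    case True
    show ?thesis
    proof (rule linearI)
      fix f g and c :: real
      have "(?a (f + g) \<longlongrightarrow> (skorokhod_apply f t - jump i f t) + (skorokhod_apply g t - jump i g t)) ?F"
        unfolding plus_skorokhod.rep_eq by (intro tendsto_intros tendsto_jump t True)
      from jumpI[OF True this] show "jump i (f + g) t = jump i f t + jump i g t"
        by (simp add: plus_skorokhod.rep_eq)
      have "(?a (c *\<^sub>R f) \<longlongrightarrow> c * (skorokhod_apply f t - jump i f t)) ?F"
        unfolding scaleR_skorokhod.rep_eq by (intro tendsto_intros tendsto_jump t True)
      from jumpI[OF True this] show "jump i (c *\<^sub>R f) t = c *\<^sub>R jump i f t"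
        by (simp add: scaleR_skorokhod.rep_eq algebra_simps)
    qed
  qed (simp add: jump_def linear_zero)
  have bound: "\<bar>jump i f t\<bar> \<le> 2 * norm f" for f
  proof (cases "0 < t $ i")
    case True
    have "\<bar>skorokhod_apply f t - jump i f t\<bar> \<le> norm f"
      by (rule tendsto_upperbound[OF tendsto_rabs[OF tendsto_jump[OF t True]]])
         (simp_all add: abs_skorokhod_le_norm)
    then show ?thesis using abs_skorokhod_le_norm[of f t] by linarith
  qed (simp add: jump_def)
  show "\<bar>jump i f t\<bar> \<le> 2 * norm f" by (rule bound)
  show "bounded_linear (\<lambda>f. jump i f t)"
    by (rule bounded_linear_intro[of _ 2])
       (use lin bound in \<open>simp_all add: linear_iff mult.commute\<close>)
qed

text \<open>Halving brings the norm down to 1, so that products of the functional are bounded by the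
  tensor seminorms.\<close>

lemma half_jump_functional:
  assumes "t \<in> cbox 0 1"
  obtains h where "norm h \<le> 1" "\<And>f. blinfun_apply h f = jump i f t / 2"
proof
  have bl: "bounded_linear (\<lambda>f. jump i f t / 2)"
    by (rule bounded_linear_compose[OF bounded_linear_divide bounded_linear_jump(1)[OF assms]])
  then show "blinfun_apply (Blinfun (\<lambda>f. jump i f t / 2)) f = jump i f t / 2" for f
    by (simp add: bounded_linear_Blinfun_apply)
  then show "norm (Blinfun (\<lambda>f. jump i f t / 2)) \<le> 1"
    using bounded_linear_jump(2)[OF assms, of i]
    by (intro norm_blinfun_bound) (simp_all add: bounded_linear_Blinfun_apply[OF bl] mult.commute)
qed

lemma evaluation_functional:
  obtains h where "norm h \<le> 1" "\<And>f. blinfun_apply h f = skorokhod_apply f t"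
proof
  have bl: "bounded_linear (\<lambda>f. skorokhod_apply f t)"
    by (rule bounded_linear_intro[of _ 1])
       (simp_all add: plus_skorokhod.rep_eq scaleR_skorokhod.rep_eq abs_skorokhod_le_norm)
  then show "blinfun_apply (Blinfun (\<lambda>f. skorokhod_apply f t)) f = skorokhod_apply f t" for f
    by (simp add: bounded_linear_Blinfun_apply)
  then show "norm (Blinfun (\<lambda>f. skorokhod_apply f t)) \<le> 1"
    by (intro norm_blinfun_bound) (simp_all add: abs_skorokhod_le_norm)
qed

section \<open>Uniform approximation by step functions\<close>

definition grid_floor :: "('m::finite \<Rightarrow> real set) \<Rightarrow> real ^ 'm \<Rightarrow> real ^ 'm" where
  "grid_floor G t = (\<chi> i. Max {g \<in> G i. g \<le> t $ i})"

text \<open>Since \<open>0\<close> is a grid value, the set under \<open>Max\<close> in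
  \<open>grid_floor\<close> is nonempty at every point of the cube.\<close>

locale grid =
  fixes G :: "'m::finite \<Rightarrow> real set"
  assumes finite_grid: "finite (G i)" and zero_in_grid: "0 \<in> G i" and grid_subset: "G i \<subseteq> {0..1}"
begin

lemma grid_floor_in_grid: "t \<in> cbox 0 1 \<Longrightarrow> grid_floor G t $ i \<in> {g \<in> G i. g \<le> t $ i}"
  unfolding grid_floor_def using finite_grid[of i] zero_in_grid[of i]
  by (simp only: vec_lambda_beta, intro Max_in) (auto simp: mem_box_cart)

lemma grid_floor_ge: "g \<in> G i \<Longrightarrow> g \<le> t $ i \<Longrightarrow> g \<le> grid_floor G t $ i"
  using finite_grid[of i] by (simp add: grid_floor_def)

lemma grid_point_in_cbox: "g \<in> cbox 0 1" if "\<And>i. g $ i \<in> G i"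
  unfolding mem_box_cart using that grid_subset by (metis atLeastAtMost_iff one_index subsetD zero_index)

lemma grid_floor_in_cbox: "t \<in> cbox 0 1 \<Longrightarrow> grid_floor G t \<in> cbox 0 1"
  using grid_floor_in_grid by (intro grid_point_in_cbox) blast

lemma finite_grid_points: "finite {g. \<forall>i. g $ i \<in> G i}"
proof -
  have "{g. \<forall>i. g $ i \<in> G i} \<subseteq> (\<lambda>h. \<chi> i. h i) ` PiE UNIV G"
  proof
    fix g assume "g \<in> {g. \<forall>i. g $ i \<in> G i}"
    then have "g = (\<chi> i. ($) g i)" "($) g \<in> PiE UNIV G" by auto
    then show "g \<in> (\<lambda>h. \<chi> i. h i) ` PiE UNIV G" by blast
  qed
  then show ?thesis using finite_PiE[of UNIV G] finite_grid by (auto intro: finite_surj)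
qed

text \<open>Close to \<open>t\<close>, the grid floor is constant on each octant, because the
  finitely many grid values other than \<open>t $ i\<close> keep a positive distance from
  \<open>t $ i\<close>.\<close>

lemma step_function_in_skorokhod:
  "(\<lambda>t. if t \<in> cbox 0 1 then h (grid_floor G t) else 0) \<in> skorokhod_functions" (is "?f \<in> _")
proof -
  have "\<exists>c. (?f \<longlongrightarrow> c) (inf (nhds t) (principal (octant t L)))" if t: "t \<in> cbox 0 1" for t L
  proof -
    \<comment> \<open>This is the constant value of the grid floor. A coordinate in \<open>L\<close>
      approaches \<open>t $ i\<close> from below, so the grid value \<open>t $ i\<close> itself is
      excluded there.\<close>
    define p where
      "p = (\<chi> i. Max (if i \<in> L then {g \<in> G i. g < t $ i} else {g \<in> G i. g \<le> t $ i}))"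
    have "\<forall>\<^sub>F s in nhds t. \<forall>i. \<forall>g\<in>G i. (g < t $ i \<longrightarrow> g < s $ i) \<and> (g > t $ i \<longrightarrow> g > s $ i)"
    proof (intro eventually_all_finite eventually_ball_finite finite_grid ballI eventually_conj)
      fix i g
      have lim: "((\<lambda>s. s $ i) \<longlongrightarrow> t $ i) (nhds t)" by (intro tendsto_intros filterlim_ident)
      show "\<forall>\<^sub>F s in nhds t. g < t $ i \<longrightarrow> g < s $ i"
        using order_tendstoD(1)[OF lim] by (cases "g < t $ i") auto
      show "\<forall>\<^sub>F s in nhds t. g > t $ i \<longrightarrow> g > s $ i"
        using order_tendstoD(2)[OF lim] by (cases "g > t $ i") auto
    qed
    then have "\<forall>\<^sub>F s in inf (nhds t) (principal (octant t L)). ?f s = h p"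
      unfolding eventually_inf_principal
    proof eventually_elim
      case (elim s)
      show ?case
      proof
        assume s: "s \<in> octant t L"
        have "{g \<in> G i. g \<le> s $ i} =
            (if i \<in> L then {g \<in> G i. g < t $ i} else {g \<in> G i. g \<le> t $ i})" for i
          using s elim by (cases "i \<in> L") (fastforce simp: octant_iff not_le)+
        then have "grid_floor G s = p" by (simp only: grid_floor_def p_def)
        then show "?f s = h p" using s octant_subset_cbox[OF t] by auto
      qed
    qed
    then show ?thesis by (intro exI[of _ "h p"] tendsto_eventually)
  qed
  then show ?thesis by (auto simp: skorokhod_functions_def has_octant_limits_def)
qed

end

section \<open>Uniform convergence along refining grids\<close>

text \<open>At each \<open>t\<close> the estimate holds on a ball for all large \<open>n\<close>: a
  point and its grid floor lie in octants at \<open>t\<close> whose limits agree. A finite subcover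
  makes the threshold for \<open>n\<close> uniform on the cube.\<close>

lemma uniform_grid_approximation:
  fixes f :: "'m::finite skorokhod"
  assumes G: "\<And>n. grid (G n)"
    and mesh: "\<And>n i x. x \<in> {0..1} \<Longrightarrow> \<exists>g\<in>G n i. x - inverse (real (Suc n)) < g \<and> g \<le> x"
    and A: "\<And>i a. a \<in> A i \<Longrightarrow> \<forall>\<^sub>F n in sequentially. a \<in> G n i"
    and jump: "\<And>i t. t \<in> cbox 0 1 \<Longrightarrow> t $ i \<notin> A i \<Longrightarrow> jump i f t = 0"
    and e: "e > 0"
  shows "\<forall>\<^sub>F n in sequentially. \<forall>t\<in>cbox 0 1.
    \<bar>skorokhod_apply f t - skorokhod_apply f (grid_floor (G n) t)\<bar> < e"
proof -
  define close where "close U n \<longleftrightarrow> (\<forall>s\<in>U \<inter> cbox 0 1.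
      \<bar>skorokhod_apply f s - skorokhod_apply f (grid_floor (G n) s)\<bar> < e)" for U n
  have "\<exists>U. open U \<and> t \<in> U \<and> eventually (close U) sequentially"
    if t: "t \<in> cbox 0 1" for t
  proof -
    obtain l where l: "\<And>L. (skorokhod_apply f \<longlongrightarrow> l L) (inf (nhds t) (principal (octant t L)))"
      using octant_limits_exist[OF skorokhod_apply t] by blast
    obtain d where d: "d > 0"
      "\<And>s L. dist s t < d \<Longrightarrow> s \<in> octant t L \<Longrightarrow> \<bar>skorokhod_apply f s - l L\<bar> < e / 2"
      using octant_limits_eventually[OF l half_gt_zero[OF e]] unfolding eventually_nhds_metric by auto
    \<comment> \<open>Rounding moves each coordinate by at most the mesh, so the Euclidean distance
      is at most \<open>CARD('m)\<close> times the mesh. The other \<open>d / 2\<close> is reserved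
      for the distance from \<open>s\<close> to \<open>t\<close>.\<close>
    have "(\<lambda>n. real CARD('m) * inverse (real (Suc n))) \<longlonglongrightarrow> real CARD('m) * 0"
      by (intro tendsto_intros LIMSEQ_inverse_real_of_nat)
    from order_tendstoD(2)[OF this, of "d / 2"]
    have "\<forall>\<^sub>F n in sequentially. real CARD('m) * inverse (real (Suc n)) < d / 2"
      using d(1) by simp
    moreover have "\<forall>\<^sub>F n in sequentially. \<forall>i. t $ i \<in> A i \<longrightarrow> t $ i \<in> G n i"
      using A by (intro eventually_all_finite) simp
    ultimately have near: "eventually (close (ball t (d / 2))) sequentially"
    proof eventually_elim
      case (elim n)
      interpret grid "G n" by (rule G)
      show ?case
        unfolding close_def
      proof
        fix s assume s: "s \<in> ball t (d / 2) \<inter> cbox 0 1"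
        let ?p = "grid_floor (G n) s" and ?L = "{i. s $ i < t $ i}" and ?K = "{i. grid_floor (G n) s $ i < t $ i}"
        have p_le: "?p $ i \<le> s $ i" for i using grid_floor_in_grid[of s i] s by auto
        have p_box: "?p \<in> cbox 0 1" using grid_floor_in_cbox s by blast
        have "\<bar>(?p - s) $ i\<bar> \<le> inverse (real (Suc n))" for i
        proof -
          have "s $ i \<in> {0..1}" using s by (simp add: mem_box_cart)
          from mesh[OF this] obtain g where "g \<in> G n i" "s $ i - inverse (real (Suc n)) < g" "g \<le> s $ i" by blast
          then show ?thesis using grid_floor_ge[of g i s] p_le[of i] by simp
        qed
        then have "(\<Sum>i\<in>UNIV. \<bar>(?p - s) $ i\<bar>) \<le> real CARD('m) * inverse (real (Suc n))"
          by (rule sum_bounded_above)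
        then have "dist ?p s < d / 2"
          using elim(1) norm_le_l1_cart[of "?p - s"] by (simp add: dist_norm)
        then have ps: "dist ?p t < d" "dist s t < d"
          using s d(1) dist_triangle[of ?p t s] by (simp_all add: dist_commute)
        \<comment> \<open>The grid point may fall below \<open>t\<close> in a coordinate \<open>i\<close> where \<open>s\<close> does not, but then
          \<open>t $ i \<notin> A i\<close>, so the octant limits on the two sides agree.\<close>
        have "l (?L \<union> (?K - ?L)) = l ?L"
        proof (rule octant_limit_Un[OF l t])
          show "\<forall>i\<in>?L \<union> (?K - ?L). 0 < t $ i"
            using s p_box by (auto simp: mem_box_cart intro: le_less_trans)
          fix i s' assume i: "i \<in> ?K - ?L" and s': "s' \<in> cbox 0 1" "s' $ i = t $ i"
          then have "t $ i \<notin> A i" using elim(2) grid_floor_ge[of "t $ i" i s] by auto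
          then show "jump i f s' = 0" using jump[OF s'(1)] s'(2) by simp
        qed
        also have "?L \<union> (?K - ?L) = ?K" using p_le by (auto intro: le_less_trans)
        finally have "l ?K = l ?L" .
        moreover have "\<bar>skorokhod_apply f ?p - l ?K\<bar> < e / 2" using d(2)[OF ps(1) in_octant[OF p_box]] .
        moreover have "\<bar>skorokhod_apply f s - l ?L\<bar> < e / 2" using d(2)[OF ps(2) in_octant] s by blast
        ultimately show "\<bar>skorokhod_apply f s - skorokhod_apply f ?p\<bar> < e" by linarith
      qed
    qed
    show ?thesis by (intro exI[of _ "ball t (d / 2)"] conjI near) (simp_all add: d(1))
  qed
  then obtain U where U: "\<And>t. t \<in> cbox 0 1 \<Longrightarrow> open (U t)" "\<And>t. t \<in> cbox 0 1 \<Longrightarrow> t \<in> U t"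
    "\<And>t. t \<in> cbox 0 1 \<Longrightarrow> eventually (close (U t)) sequentially"
    by metis
  obtain C where C: "C \<subseteq> cbox 0 1" "finite C" "cbox 0 1 \<subseteq> (\<Union>t\<in>C. U t)"
    by (rule compactE_image[OF compact_cbox[of 0 "1 :: real ^ 'm"], of "cbox 0 1" U]) (use U in auto)
  have "\<forall>\<^sub>F n in sequentially. \<forall>t\<in>C. close (U t) n"
    using C U(3) by (intro eventually_ball_finite) auto
  then show ?thesis
  proof eventually_elim
    case (elim n)
    show ?case
    proof
      fix s :: "real ^ 'm" assume s: "s \<in> cbox 0 1"
      then obtain t where "t \<in> C" "s \<in> U t" using C(3) by blast
      then show "\<bar>skorokhod_apply f s - skorokhod_apply f (grid_floor (G n) s)\<bar> < e"
        using elim s by (simp add: close_def)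
    qed
  qed
qed

section \<open>Simple functions and rounding of values\<close>

text \<open>\<open>S\<close> factors through the tuple of all \<open>h i\<close>, which takes
  finitely many values on measurable level sets.\<close>

lemma simple_function_finite_determined:
  assumes "finite I" and h: "\<And>i. i \<in> I \<Longrightarrow> simple_function M (h i)"
    and S: "\<And>w w'. w \<in> space M \<Longrightarrow> w' \<in> space M \<Longrightarrow> \<forall>i\<in>I. h i w = h i w' \<Longrightarrow> S w = S w'"
  shows "simple_function M S"
proof -
  define H where "H w = (\<lambda>i\<in>I. h i w)" for w
  have fin: "finite (H ` space M)"
  proof (rule finite_subset)
    show "H ` space M \<subseteq> PiE I (\<lambda>i. h i ` space M)" by (auto simp: H_def)
    show "finite (PiE I (\<lambda>i. h i ` space M))"
      using assms(1) h by (intro finite_PiE) (auto simp: simple_function_def)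
  qed
  have "H -` {H w} \<inter> space M \<in> sets M" if w: "w \<in> space M" for w
  proof -
    have "H -` {H w} \<inter> space M = {w' \<in> space M. \<forall>i\<in>I. h i w' = h i w}"
      by (auto simp: H_def fun_eq_iff restrict_def; meson)
    also have "\<dots> \<in> sets M"
    proof (rule sets.sets_Collect_finite_All[OF _ assms(1)])
      fix i assume "i \<in> I"
      then have "h i -` {h i w} \<inter> space M \<in> sets M" using h w by (auto simp: simple_function_def)
      also have "h i -` {h i w} \<inter> space M = {w' \<in> space M. h i w' = h i w}" by auto
      finally show "{w' \<in> space M. h i w' = h i w} \<in> sets M" .
    qed
    finally show ?thesis .
  qed
  with fin have "simple_function M H" by (auto simp: simple_function_def)
  \<comment> \<open>The choice picks one representative in each fibre of \<open>H\<close>;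
    \<open>S\<close> is constant on fibres, so it is recovered from \<open>H\<close>.\<close>
  from simple_function_compose1[OF this, of "\<lambda>v. S (SOME w. w \<in> space M \<and> H w = v)"]
  have "simple_function M (\<lambda>w. S (SOME w'. w' \<in> space M \<and> H w' = H w))" .
  moreover have "S (SOME w'. w' \<in> space M \<and> H w' = H w) = S w" if w: "w \<in> space M" for w
  proof -
    define W where W: "W = (SOME w'. w' \<in> space M \<and> H w' = H w)"
    have "W \<in> space M \<and> H W = H w" unfolding W by (rule someI[of _ w]) (use w in auto)
    then have "W \<in> space M" "H W = H w" by auto
    have "h i W = h i w" if "i \<in> I" for i
    proof -
      have "h i W = H W i" using that by (simp add: H_def)
      also have "\<dots> = h i w" unfolding \<open>H W = H w\<close> using that by (simp add: H_def)
      finally show ?thesis .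
    qed
    then show ?thesis unfolding W[symmetric] using \<open>W \<in> space M\<close> by (intro S w) auto
  qed
  ultimately show ?thesis using simple_function_cong[of M] by (metis (no_types, lifting))
qed

text \<open>Clipping to \<open>[-n, n]\<close> makes the range finite, as simple functions require.
  It changes nothing at a given value once \<open>n\<close> is large.\<close>

definition quantize :: "nat \<Rightarrow> real \<Rightarrow> real" where
  "quantize n x = real_of_int \<lfloor>max (- real n) (min (real n) x) * real (Suc n)\<rfloor> / real (Suc n)"

lemma quantize_close: "\<bar>x\<bar> \<le> real n \<Longrightarrow> \<bar>quantize n x - x\<bar> \<le> inverse (real (Suc n))"
proof -
  assume "\<bar>x\<bar> \<le> real n"
  then have "quantize n x = real_of_int \<lfloor>x * real (Suc n)\<rfloor> / real (Suc n)" by (simp add: quantize_def)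
  then have "quantize n x - x = (real_of_int \<lfloor>x * real (Suc n)\<rfloor> - x * real (Suc n)) / real (Suc n)"
    by (simp add: field_simps)
  also have "\<bar>\<dots>\<bar> \<le> 1 / real (Suc n)"
    unfolding abs_divide by (intro divide_mono) (auto, linarith)
  finally show ?thesis by (simp add: inverse_eq_divide)
qed

lemma finite_range_quantize: "finite (range (quantize n))"
proof -
  let ?N = "int (n * Suc n)"
  have "range (quantize n) \<subseteq> (\<lambda>k. real_of_int k / real (Suc n)) ` {- ?N..?N}"
  proof clarify
    fix x
    let ?y = "max (- real n) (min (real n) x) * real (Suc n)"
    have "- real n * real (Suc n) \<le> ?y" "?y \<le> real n * real (Suc n)"
      by (intro mult_right_mono; simp)+
    moreover have "real_of_int ?N = real n * real (Suc n)" by (simp only: of_int_of_nat_eq of_nat_mult of_int_mult)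
    ultimately have "real_of_int (- ?N) \<le> ?y" "?y \<le> real_of_int ?N"
      by (simp_all only: of_int_minus mult_minus_left)
    then have "- ?N \<le> \<lfloor>?y\<rfloor> \<and> \<lfloor>?y\<rfloor> \<le> ?N"
      unfolding le_floor_iff floor_le_iff by linarith
    then show "quantize n x \<in> (\<lambda>k. real_of_int k / real (Suc n)) ` {- ?N..?N}"
      unfolding quantize_def by (intro image_eqI[of _ _ "\<lfloor>?y\<rfloor>"]) auto
  qed
  then show ?thesis by (rule finite_surj[rotated]) simp
qed

lemma quantize_measurable [measurable]: "quantize n \<in> borel_measurable borel"
  unfolding quantize_def by measurable

text \<open>The approximant samples \<open>X\<close> on a finite grid and quantizes the samples, so
  it is determined by finitely many simple real random variables. The grids exhaust the countable
  sets \<open>A i\<close>, which makes the convergence uniform in \<open>t\<close>.\<close>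

lemma skorokhod_simple_approximation:
  fixes X :: "'w \<Rightarrow> 'm::finite skorokhod"
  assumes X: "\<And>t. t \<in> cbox 0 1 \<Longrightarrow> (\<lambda>w. skorokhod_apply (X w) t) \<in> borel_measurable M"
    and A: "\<And>i. countable (A i)" "\<And>i. A i \<subseteq> {0..1}"
    and jump: "\<And>i. AE w in M. \<forall>t\<in>cbox 0 1. t $ i \<notin> A i \<longrightarrow> jump i (X w) t = 0"
  shows "\<exists>S. (\<forall>n. simple_function M (S n)) \<and> (AE w in M. (\<lambda>n. S n w) \<longlonglongrightarrow> X w)"
proof -
  \<comment> \<open>If \<open>A i\<close> is empty, the enumeration has an arbitrary value; the
    intersection with \<open>{0..1}\<close> in \<open>G\<close> keeps the grid inside the unit
    interval.\<close>
  define a where "a i = from_nat_into (A i)" for i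
  have a: "A i \<subseteq> range (a i)" for i
    unfolding a_def using A(1) by (rule subset_range_from_nat_into)
  \<comment> \<open>The equidistant points control the mesh, and the initial segments of the
    enumeration eventually capture each point of \<open>A i\<close>.\<close>
  define G where "G n i = (\<lambda>k. real k / real (Suc n)) ` {..Suc n} \<union> a i ` {..n} \<inter> {0..1}" for n and i :: 'm
  have G: "grid (G n)" for n
  proof
    fix i
    show "finite (G n i)" by (simp add: G_def)
    show "0 \<in> G n i" by (auto simp: G_def intro: image_eqI[of _ _ 0])
    show "G n i \<subseteq> {0..1}" by (auto simp: G_def)
  qed
  have mesh: "\<exists>g\<in>G n i. x - inverse (real (Suc n)) < g \<and> g \<le> x" if x: "x \<in> {0..1}" for n i x
  proof (intro bexI conjI)
    let ?k = "nat \<lfloor>x * real (Suc n)\<rfloor>"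
    have k: "real ?k \<le> x * real (Suc n)" "x * real (Suc n) < real ?k + 1"
      using x by (simp_all add: floor_less_iff)
    have "x * real (Suc n) \<le> real (Suc n)" using x by (simp add: mult_left_le_one_le)
    then have "?k \<le> Suc n" using k(1) by linarith
    then show "real ?k / real (Suc n) \<in> G n i" by (auto simp: G_def)
    show "real ?k / real (Suc n) \<le> x" using k(1) by (simp add: field_simps)
    show "x - inverse (real (Suc n)) < real ?k / real (Suc n)"
    proof -
      have "x < (real ?k + 1) / real (Suc n)" using k(2) by (simp only: pos_less_divide_eq of_nat_0_less_iff zero_less_Suc)
      then show ?thesis by (simp add: add_divide_distrib inverse_eq_divide)
    qed
  qed
  have AG: "\<forall>\<^sub>F n in sequentially. x \<in> G n i" if "x \<in> A i" for i x
  proof -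
    obtain k where k: "x = a i k" using a \<open>x \<in> A i\<close> by blast
    then have "x \<in> G n i" if "n \<ge> k" for n using \<open>x \<in> A i\<close> A(2) that unfolding G_def by blast
    then show ?thesis unfolding eventually_sequentially by blast
  qed
  define S where "S n w = Abs_skorokhod (\<lambda>t. if t \<in> cbox 0 1
      then quantize n (skorokhod_apply (X w) (grid_floor (G n) t)) else 0)" for n w
  have S: "skorokhod_apply (S n w) t = quantize n (skorokhod_apply (X w) (grid_floor (G n) t))"
    if "t \<in> cbox 0 1" for n w t
    unfolding S_def using that
    by (subst Abs_skorokhod_inverse)
       (rule grid.step_function_in_skorokhod[OF G, of "\<lambda>p. quantize n (skorokhod_apply (X w) p)" for n w], simp)
  have "simple_function M (S n)" for n
  proof (rule simple_function_finite_determined)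
    interpret grid "G n" by (rule G)
    show "finite {g. \<forall>i. g $ i \<in> G n i}" by (rule finite_grid_points)
    show "simple_function M (\<lambda>w. quantize n (skorokhod_apply (X w) g))" if "g \<in> {g. \<forall>i. g $ i \<in> G n i}" for g
    proof (rule simple_function_borel_measurable)
      have "g \<in> cbox 0 1" using that by (intro grid_point_in_cbox) blast
      from X[OF this] show "(\<lambda>w. quantize n (skorokhod_apply (X w) g)) \<in> borel_measurable M" by measurable
      show "finite ((\<lambda>w. quantize n (skorokhod_apply (X w) g)) ` space M)"
        by (rule finite_subset[OF _ finite_range_quantize]) auto
    qed
    show "S n w = S n w'"
      if "\<forall>g\<in>{g. \<forall>i. g $ i \<in> G n i}. quantize n (skorokhod_apply (X w) g) = quantize n (skorokhod_apply (X w') g)"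
      for w w'
    proof -
      have "grid_floor (G n) t \<in> {g. \<forall>i. g $ i \<in> G n i}" if "t \<in> cbox 0 1" for t
        using grid_floor_in_grid[OF that] by auto
      then show ?thesis using that unfolding S_def by (intro arg_cong[of _ _ Abs_skorokhod] ext) auto
    qed
  qed
  moreover have "AE w in M. \<forall>i. \<forall>t\<in>cbox 0 1. t $ i \<notin> A i \<longrightarrow> jump i (X w) t = 0"
    using jump by (subst AE_all_countable) auto
  then have "AE w in M. (\<lambda>n. S n w) \<longlonglongrightarrow> X w"
  proof eventually_elim
    case (elim w)
    show ?case
    proof (rule tendstoI)
      fix e :: real assume e: "e > 0"
      have "\<forall>\<^sub>F n in sequentially. \<forall>t\<in>cbox 0 1.
          \<bar>skorokhod_apply (X w) t - skorokhod_apply (X w) (grid_floor (G n) t)\<bar> < e / 3"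
        using elim e by (intro uniform_grid_approximation[where A = A] G mesh AG) auto
      moreover have "\<forall>\<^sub>F n in sequentially. inverse (real (Suc n)) < e / 3"
        using e by (intro order_tendstoD(2)[OF LIMSEQ_inverse_real_of_nat]) simp
      moreover have "\<forall>\<^sub>F n in sequentially. norm (X w) \<le> real n"
        using eventually_ge_at_top[of "nat \<lceil>norm (X w)\<rceil>"] by eventually_elim linarith
      ultimately show "\<forall>\<^sub>F n in sequentially. dist (S n w) (X w) < e"
      proof eventually_elim
        case (elim n)
        \<comment> \<open>One third is the grid error and one third the quantization error; the rest
          keeps the inequality strict after passing to the supremum.\<close>
        have "norm (S n w - X w) \<le> 2 * e / 3"
        proof (rule norm_skorokhod_le)
          fix t :: "real ^ 'm" assume t: "t \<in> cbox 0 1"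
          let ?x = "skorokhod_apply (X w) (grid_floor (G n) t)"
          have "\<bar>quantize n ?x - ?x\<bar> \<le> inverse (real (Suc n))"
            using abs_skorokhod_le_norm[of "X w"] elim(3) by (intro quantize_close) (rule order_trans)
          moreover have "\<bar>skorokhod_apply (X w) t - ?x\<bar> < e / 3" using elim(1) t by blast
          ultimately show "\<bar>skorokhod_apply (S n w - X w) t\<bar> \<le> 2 * e / 3"
            unfolding minus_skorokhod.rep_eq S[OF t] using elim(2) by linarith
        qed
        then show ?case using e by (simp add: dist_norm)
      qed
    qed
  qed
  ultimately show ?thesis by blast
qed

section \<open>Continuity of tensor powers\<close>

lemma abs_product_form_le_sum:
  assumes f: "\<forall>i. norm (f i) \<le> 1"
  shows "\<bar>tensor_sum xs (product_form f)\<bar> \<le> (\<Sum>x\<leftarrow>xs. \<Prod>i\<in>UNIV. norm (x i))"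
proof (induct xs)
  case (Cons x xs)
  have "norm (blinfun_apply (f i) (x i)) \<le> norm (x i)" for i
    using norm_blinfun[of "f i" "x i"] f mult_right_mono[of "norm (f i)" 1 "norm (x i)"] by simp
  then have "\<bar>\<Prod>i\<in>UNIV. blinfun_apply (f i) (x i)\<bar> \<le> (\<Prod>i\<in>UNIV. norm (x i))"
    unfolding abs_prod by (intro prod_mono) auto
  then show ?case using Cons by (simp add: tensor_sum_def mform_apply_product_form)
qed simp

text \<open>Every representation of \<open>T\<close> as a sum of elementary tensors gives a bound,
  so the infimum does too.\<close>

lemma abs_product_form_le_projective:
  assumes T: "T \<in> algebraic_tensors" and f: "\<forall>i. norm (f i) \<le> 1"
  shows "\<bar>T (product_form f)\<bar> \<le> projective_seminorm T"
  unfolding projective_seminorm_def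
proof (rule cInf_greatest)
  show "{\<Sum>x\<leftarrow>xs. \<Prod>i\<in>UNIV. norm (x i) |xs. tensor_sum xs = T} \<noteq> {}"
    using T by (auto simp: algebraic_tensors_def)
  fix b assume "b \<in> {\<Sum>x\<leftarrow>xs. \<Prod>i\<in>UNIV. norm (x i) |xs. tensor_sum xs = T}"
  then obtain xs where "T = tensor_sum xs" "b = (\<Sum>x\<leftarrow>xs. \<Prod>i\<in>UNIV. norm (x i))" by blast
  then show "\<bar>T (product_form f)\<bar> \<le> b" using abs_product_form_le_sum[OF f, of xs] by simp
qed

lemma abs_product_form_le_injective:
  assumes "T \<in> algebraic_tensors" "\<forall>i. norm (f i) \<le> 1"
  shows "\<bar>T (product_form f)\<bar> \<le> injective_seminorm T"
  unfolding injective_seminorm_def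
  by (rule cSUP_upper[OF _ injective_seminorm_bdd]) (use assms in auto)

lemma injective_le_projective_seminorm:
  assumes "T \<in> algebraic_tensors"
  shows "injective_seminorm T \<le> projective_seminorm T"
  unfolding injective_seminorm_def
  by (rule cSUP_least) (auto intro!: exI[of _ "\<lambda>_. 0"] abs_product_form_le_projective assms)

text \<open>Local Lipschitz continuity of the power by telescoping: each of the
  \<open>CARD('l)\<close> terms is an elementary tensor with one factor \<open>x - y\<close> and all
  others of norm at most \<open>K\<close>.\<close>

lemma projective_seminorm_power_diff:
  fixes x y :: "'a::real_normed_vector"
  defines "K \<equiv> norm x + norm y"
  shows "projective_seminorm (\<lambda>\<phi> :: ('a, 'l::finite) multilinear_form. mform_apply \<phi> (\<lambda>_. x) - mform_apply \<phi> (\<lambda>_. y))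
    \<le> real CARD('l) * (norm (x - y) * K ^ (CARD('l) - 1))"
proof -
  let ?z = "\<lambda>I i. if i \<in> I then x else y"
  \<comment> \<open>The factors \<open>y\<close> are replaced by \<open>x\<close> one at a time.\<close>
  let ?D = "\<lambda>I \<phi>. mform_apply \<phi> (?z I) - mform_apply \<phi> (\<lambda>_. y)"
  have T: "tensor_sum [z] = (\<lambda>\<phi>. mform_apply \<phi> z)" for z :: "'l \<Rightarrow> 'a" by (simp add: tensor_sum_def)
  have alg: "(\<lambda>\<phi>. mform_apply \<phi> z) \<in> algebraic_tensors" for z :: "'l \<Rightarrow> 'a"
    unfolding algebraic_tensors_def T[symmetric] by blast
  have "projective_seminorm (?D I) \<le> real (card I) * (norm (x - y) * K ^ (CARD('l) - 1))"
    if "finite I" for I :: "'l set"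
    using that
  proof (induction I rule: finite_induct)
    case empty
    show ?case using projective_seminorm_le[of "[] :: ('l \<Rightarrow> 'a) list"] by simp
  next
    case (insert i I)
    let ?d = "(?z I)(i := x - y)"
    have "?z (insert i I) = (?z I)(i := x)" "?z I = (?z I)(i := y)" using insert(2) by auto
    then have "mform_apply \<phi> (?z (insert i I)) = mform_apply \<phi> (?z I) + mform_apply \<phi> ?d"
      for \<phi> :: "('a, 'l) multilinear_form"
      using linear_diff[OF linear_mform_apply, of \<phi> "?z I" i x y] by simp
    then have "?D (insert i I) = (\<lambda>\<phi>. ?D I \<phi> + mform_apply \<phi> ?d)" by (simp add: fun_eq_iff)
    then have "projective_seminorm (?D (insert i I)) = projective_seminorm (\<lambda>\<phi>. ?D I \<phi> + mform_apply \<phi> ?d)"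
      by (rule arg_cong)
    also have "\<dots> \<le> projective_seminorm (?D I) + projective_seminorm (\<lambda>\<phi>. mform_apply \<phi> ?d)"
      by (rule projective_seminorm_triangle[OF algebraic_tensors_diff[OF alg alg] alg])
    finally have "projective_seminorm (?D (insert i I)) \<le>
        projective_seminorm (?D I) + projective_seminorm (\<lambda>\<phi>. mform_apply \<phi> ?d)" .
    moreover have "projective_seminorm (\<lambda>\<phi>. mform_apply \<phi> ?d) \<le> norm (x - y) * K ^ (CARD('l) - 1)"
    proof -
      have "projective_seminorm (\<lambda>\<phi>. mform_apply \<phi> ?d) \<le> (\<Prod>j\<in>UNIV. norm (?d j))"
        using projective_seminorm_le[of "[?d]"] by (simp add: T)
      also have "\<dots> = norm (x - y) * (\<Prod>j\<in>UNIV - {i}. norm (?z I j))"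
        by (subst prod.remove[of _ i]) simp_all
      also have "(\<Prod>j\<in>UNIV - {i}. norm (?z I j)) \<le> (\<Prod>j\<in>UNIV - {i}. K)"
        by (intro prod_mono) (auto simp: K_def)
      finally show ?thesis by (simp add: mult_left_mono)
    qed
    ultimately show ?case using insert by (simp add: algebra_simps)
  qed
  from this[of UNIV] show ?thesis by simp
qed

lemma norm_projective_power_diff:
  "norm (projective_power x - projective_power y :: ('a::real_normed_vector, 'l::finite) projective_tensor_power)
    = projective_seminorm (\<lambda>\<phi> :: ('a, 'l) multilinear_form. mform_apply \<phi> (\<lambda>_. x) - mform_apply \<phi> (\<lambda>_. y))"
  unfolding projective_power_def to_completion_diff[symmetric] norm_to_completion
    seminorm_projective_alg.rep_eq minus_projective_alg.rep_eq
  by (simp add: Abs_projective_alg_inverse algebraic_tensors_def) (simp add: tensor_sum_def)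

lemma norm_injective_power_diff:
  "norm (injective_power x - injective_power y :: ('a::real_normed_vector, 'l::finite) injective_tensor_power)
    = injective_seminorm (\<lambda>\<phi> :: ('a, 'l) multilinear_form. mform_apply \<phi> (\<lambda>_. x) - mform_apply \<phi> (\<lambda>_. y))"
  unfolding injective_power_def to_completion_diff[symmetric] norm_to_completion
    seminorm_injective_alg.rep_eq minus_injective_alg.rep_eq
  by (simp add: Abs_injective_alg_inverse algebraic_tensors_def) (simp add: tensor_sum_def)

text \<open>Transfers continuity from the projective power to the injective one.\<close>

lemma norm_injective_power_diff_le:
  "norm (injective_power x - injective_power y :: ('a::real_normed_vector, 'l::finite) injective_tensor_power)
    \<le> norm (projective_power x - projective_power y :: ('a, 'l) projective_tensor_power)"
proof -
  have "(\<lambda>\<phi>. mform_apply \<phi> (\<lambda>_. z)) = tensor_sum [\<lambda>_ :: 'l. z]" for z :: 'a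
    by (simp add: tensor_sum_def)
  then have "(\<lambda>\<phi>. mform_apply \<phi> (\<lambda>_. z)) \<in> (algebraic_tensors :: (('a, 'l) multilinear_form \<Rightarrow> real) set)" for z
    by (simp add: algebraic_tensors_def)
  then show ?thesis
    unfolding norm_projective_power_diff norm_injective_power_diff
    by (intro injective_le_projective_seminorm algebraic_tensors_diff)
qed

lemma tendsto_projective_power:
  assumes "S \<longlonglongrightarrow> x"
  shows "(\<lambda>n. projective_power (S n) :: ('a::real_normed_vector, 'l::finite) projective_tensor_power)
    \<longlonglongrightarrow> projective_power x"
proof (rule LIM_zero_cancel, rule Lim_null_comparison)
  show "\<forall>\<^sub>F n in sequentially. norm (projective_power (S n) - projective_power x :: ('a, 'l) projective_tensor_power)
      \<le> real CARD('l) * (norm (S n - x) * (norm (S n) + norm x) ^ (CARD('l) - 1))"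
    unfolding norm_projective_power_diff
    by (intro always_eventually allI projective_seminorm_power_diff)
  have "(\<lambda>n. real CARD('l) * (norm (S n - x) * (norm (S n) + norm x) ^ (CARD('l) - 1)))
      \<longlonglongrightarrow> real CARD('l) * (norm (x - x) * (norm x + norm x) ^ (CARD('l) - 1))"
    by (intro tendsto_intros assms)
  then show "(\<lambda>n. real CARD('l) * (norm (S n - x) * (norm (S n) + norm x) ^ (CARD('l) - 1))) \<longlonglongrightarrow> 0"
    by simp
qed

lemma tendsto_injective_power:
  assumes "S \<longlonglongrightarrow> x"
  shows "(\<lambda>n. injective_power (S n) :: ('a::real_normed_vector, 'l::finite) injective_tensor_power)
    \<longlonglongrightarrow> injective_power x"
proof (rule LIM_zero_cancel, rule Lim_null_comparison)
  show "\<forall>\<^sub>F n in sequentially. norm (injective_power (S n) - injective_power x :: ('a, 'l) injective_tensor_power)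
      \<le> norm (projective_power (S n) - projective_power x :: ('a, 'l) projective_tensor_power)"
    by (intro always_eventually allI norm_injective_power_diff_le)
  show "(\<lambda>n. norm (projective_power (S n) - projective_power x :: ('a, 'l) projective_tensor_power)) \<longlonglongrightarrow> 0"
    by (intro tendsto_norm_zero LIM_zero tendsto_projective_power assms)
qed

lemma norm_projective_power_le:
  "norm (projective_power x :: ('a::real_normed_vector, 'l::finite) projective_tensor_power) \<le> norm x ^ CARD('l)"
  using projective_seminorm_le[of "[\<lambda>_ :: 'l. x]"]
  by (simp add: projective_power_def norm_to_completion seminorm_projective_alg.rep_eq
      Abs_projective_alg_inverse algebraic_tensors_def)

lemma norm_injective_power_le:
  "norm (injective_power x :: ('a::real_normed_vector, 'l::finite) injective_tensor_power) \<le> norm x ^ CARD('l)"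
proof -
  have "injective_seminorm (tensor_sum [\<lambda>_ :: 'l. x]) \<le> projective_seminorm (tensor_sum [\<lambda>_ :: 'l. x])"
    by (rule injective_le_projective_seminorm) (simp add: algebraic_tensors_def)
  also have "\<dots> \<le> norm x ^ CARD('l)"
    using projective_seminorm_le[of "[\<lambda>_ :: 'l. x]"] by simp
  finally show ?thesis
    by (simp add: injective_power_def norm_to_completion seminorm_injective_alg.rep_eq
        Abs_injective_alg_inverse algebraic_tensors_def)
qed

section \<open>Bochner integrability of tensor powers\<close>

text \<open>The map \<open>P\<close> stands for either tensor power. It carries simple functions to
  simple functions and, by continuity, preserves their convergence.\<close>

lemma Bochner_integrable_power:
  fixes X :: "'w \<Rightarrow> 'm::finite skorokhod" and P :: "'m skorokhod \<Rightarrow> 'b::real_normed_vector"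
  assumes X: "\<And>t. t \<in> cbox 0 1 \<Longrightarrow> (\<lambda>w. skorokhod_apply (X w) t) \<in> borel_measurable M"
    and cont: "\<And>S x. S \<longlonglongrightarrow> x \<Longrightarrow> (\<lambda>n. P (S n)) \<longlonglongrightarrow> P x"
    and norm: "\<And>x. norm (P x) \<le> norm x ^ k"
    and moment: "(\<integral>\<^sup>+w. ennreal (norm (X w) ^ k) \<partial>M) < \<infinity>"
    and A: "\<And>i. countable (A i) \<and> A i \<subseteq> {0..1}"
    and jump: "\<And>i. AE w in M. \<forall>t\<in>cbox 0 1. t $ i \<notin> A i \<longrightarrow> jump i (X w) t = 0"
  shows "Bochner_integrable M (\<lambda>w. P (X w))"
proof -
  obtain S where S: "\<And>n. simple_function M (S n)" "AE w in M. (\<lambda>n. S n w) \<longlonglongrightarrow> X w"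
    using skorokhod_simple_approximation[where M = M and X = X and A = A, OF X _ _ jump] A by blast
  have "AE w in M. (\<lambda>n. P (S n w)) \<longlonglongrightarrow> P (X w)" using S(2) by eventually_elim (rule cont)
  moreover have "simple_function M (\<lambda>w. P (S n w))" for n using S(1) by (rule simple_function_compose1)
  moreover have "(\<integral>\<^sup>+w. ennreal (norm (P (X w))) \<partial>M) < \<infinity>"
    by (rule le_less_trans[OF nn_integral_mono moment]) (simp add: norm ennreal_leI)
  ultimately show ?thesis unfolding Bochner_integrable_def by (intro conjI exI[of _ "\<lambda>n w. P (S n w)"]) auto
qed

section \<open>Necessity of the moment and jump conditions\<close>

text \<open>A common form for both tensor norms: \<open>P\<close> is the algebraic power and
  \<open>ev h\<close> the product functional with all factors \<open>h\<close>. The assumption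
  \<open>ev_zero\<close> says that an algebraic tensor involves finitely many vectors, so
  \<open>ev h\<close> kills it as soon as \<open>h\<close> kills those.\<close>

lemma Bochner_integrable_powerD:
  fixes X :: "'w \<Rightarrow> 'm::finite skorokhod" and P :: "'m skorokhod \<Rightarrow> 'c::seminormed_vector"
    and ev :: "('m skorokhod \<Rightarrow>\<^sub>L real) \<Rightarrow> 'c \<Rightarrow> real"
  assumes ev_diff: "\<And>h c c'. ev h (c - c') = ev h c - ev h c'"
    and ev_bound: "\<And>h c. norm h \<le> 1 \<Longrightarrow> \<bar>ev h c\<bar> \<le> seminorm c"
    and ev_power: "\<And>h f. ev h (P f) = blinfun_apply h f ^ k" and k: "k > 0"
    and ev_zero: "\<And>c. \<exists>F. finite F \<and> (\<forall>h. (\<forall>g\<in>F. blinfun_apply h g = 0) \<longrightarrow> ev h c = 0)"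
    and int: "Bochner_integrable M (\<lambda>w. to_completion (P (X w)))"
  shows "(\<integral>\<^sup>+w. ennreal (norm (X w) ^ k) \<partial>M) < \<infinity>"
    and "\<exists>A :: 'm \<Rightarrow> real set. (\<forall>i. countable (A i) \<and> A i \<subseteq> {0..1}) \<and>
        (\<forall>i. AE w in M. \<forall>t\<in>cbox 0 1. t $ i \<notin> A i \<longrightarrow> jump i (X w) t = 0)"
proof -
  obtain s :: "nat \<Rightarrow> 'w \<Rightarrow> 'c completion" where s: "\<And>n. simple_function M (s n)"
    "AE w in M. (\<lambda>n. s n w) \<longlonglongrightarrow> to_completion (P (X w))"
    and moment: "(\<integral>\<^sup>+w. ennreal (norm (to_completion (P (X w)))) \<partial>M) < \<infinity>"
    using int unfolding Bochner_integrable_def by blast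
  have "norm f ^ k \<le> norm (to_completion (P f))" for f
  proof -
    \<comment> \<open>The point evaluation has norm at most 1, so its \<open>k\<close>-th power is
      bounded by the seminorm of \<open>P f\<close>. Taking the root first allows the supremum over
      \<open>t\<close>.\<close>
    have "\<bar>skorokhod_apply f t\<bar> \<le> root k (seminorm (P f))" for t
    proof -
      obtain h where h: "norm h \<le> 1" "\<And>f. blinfun_apply h f = skorokhod_apply f t"
        using evaluation_functional[of t] by blast
      have "\<bar>skorokhod_apply f t\<bar> ^ k \<le> seminorm (P f)"
        using ev_bound[OF h(1), of "P f"] by (simp add: ev_power h(2) power_abs)
      then have "root k (\<bar>skorokhod_apply f t\<bar> ^ k) \<le> root k (seminorm (P f))"
        using k by simp
      then show ?thesis using k by (simp add: real_root_power_cancel)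
    qed
    then have "norm f \<le> root k (seminorm (P f))" by (intro norm_skorokhod_le)
    then have "norm f ^ k \<le> root k (seminorm (P f)) ^ k" by (intro power_mono) simp_all
    then show ?thesis using k by (simp add: norm_to_completion)
  qed
  then show "(\<integral>\<^sup>+w. ennreal (norm (X w) ^ k) \<partial>M) < \<infinity>"
    by (intro le_less_trans[OF nn_integral_mono moment] ennreal_leI)
  define V where "V = (\<Union>n. s n ` space M)"
  have "countable V"
    unfolding V_def
    by (rule countable_UN) (use s(1) in \<open>auto intro: countable_finite simp: simple_function_def\<close>)
  have "\<exists>d. norm (v - to_completion d) < inverse (real (Suc j))" for v :: "'c completion" and j
    by (rule to_completion_dense) simp
  then obtain c :: "'c completion \<Rightarrow> nat \<Rightarrow> 'c"
    where c: "\<And>v j. norm (v - to_completion (c v j)) < inverse (real (Suc j))" by metis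
  obtain F where F: "\<And>d. finite (F d)"
    "\<And>d h. (\<And>g. g \<in> F d \<Longrightarrow> blinfun_apply h g = 0) \<Longrightarrow> ev h d = 0"
    using ev_zero by metis
  \<comment> \<open>All jump coordinates of the countably many functions that occur in the algebraic
    approximants \<open>c v j\<close> of values \<open>v\<close> of the simple functions.\<close>
  define A where "A i = (\<Union>v\<in>V. \<Union>j. \<Union>g\<in>F (c v j). jump_coords i g)" for i
  have "countable (A i)" for i
    unfolding A_def using \<open>countable V\<close> F(1)
    by (intro countable_UN countable_jump_coords) (auto intro: countable_finite)
  moreover have "A i \<subseteq> {0..1}" for i
    unfolding A_def using jump_coords_subset by blast
  \<comment> \<open>The exceptional null set is the one where \<open>s n w\<close> fails to
    converge. It is fixed before \<open>t\<close>, so the conclusion holds for all \<open>t\<close>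
    at once.\<close>
  moreover have "AE w in M. \<forall>t\<in>cbox 0 1. t $ i \<notin> A i \<longrightarrow> jump i (X w) t = 0" for i
    using s(2) AE_space
  proof eventually_elim
    case (elim w)
    show ?case
    proof (intro ballI impI)
      fix t :: "real ^ 'm" assume t: "t \<in> cbox 0 1" "t $ i \<notin> A i"
      obtain h where h: "norm h \<le> 1" "\<And>f. blinfun_apply h f = jump i f t / 2"
        using half_jump_functional[OF t(1), of i] by blast
      have "\<bar>ev h (P (X w))\<bar> \<le> e" if e: "e > 0" for e
      proof -
        obtain n where n: "norm (s n w - to_completion (P (X w))) < e / 2"
          using LIMSEQ_D[OF elim(1) half_gt_zero[OF e]] by blast
        obtain j where j: "inverse (real (Suc j)) < e / 2"
          using reals_Archimedean[OF half_gt_zero[OF e]] by blast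
        have V: "s n w \<in> V" using elim(2) by (auto simp: V_def)
        let ?c = "c (s n w) j"
        have "blinfun_apply h g = 0" if g: "g \<in> F ?c" for g
        proof -
          have "t $ i \<notin> jump_coords i g" using t(2) V g unfolding A_def by blast
          then show ?thesis using t(1) by (auto simp: h(2) jump_coords_def)
        qed
        then have zero: "ev h ?c = 0" by (rule F(2))
        \<comment> \<open>The functional \<open>ev h\<close> vanishes at \<open>?c\<close>, so its
          value at \<open>P (X w)\<close> is bounded by the distance of the two, which is below
          \<open>e\<close>.\<close>
        have "seminorm (P (X w) - ?c) = norm ((s n w - to_completion ?c) - (s n w - to_completion (P (X w))))"
          by (simp add: to_completion_diff flip: norm_to_completion)
        also have "\<dots> < e"
          using norm_triangle_ineq4[of "s n w - to_completion ?c" "s n w - to_completion (P (X w))"]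
            n j c[of "s n w" j] by linarith
        finally show ?thesis using ev_bound[OF h(1), of "P (X w) - ?c"] by (simp add: ev_diff zero)
      qed
      then have "ev h (P (X w)) = 0" using field_le_epsilon[of "\<bar>ev h (P (X w))\<bar>" 0] by simp
      then show "jump i (X w) t = 0" by (simp add: ev_power h(2))
    qed
  qed
  ultimately show "\<exists>A :: 'm \<Rightarrow> real set. (\<forall>i. countable (A i) \<and> A i \<subseteq> {0..1}) \<and>
      (\<forall>i. AE w in M. \<forall>t\<in>cbox 0 1. t $ i \<notin> A i \<longrightarrow> jump i (X w) t = 0)" by blast
qed

text \<open>\<open>F\<close> collects all factors of one representation of the tensor; if
  \<open>h\<close> vanishes on them, every product in the sum has a zero factor.\<close>

lemma algebraic_tensors_finite_support:
  assumes "T \<in> algebraic_tensors"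
  shows "\<exists>F. finite F \<and> (\<forall>h. (\<forall>g\<in>F. blinfun_apply h g = 0) \<longrightarrow> T (product_form (\<lambda>_. h)) = 0)"
proof -
  obtain xs where T: "T = tensor_sum xs" using assms by (auto simp: algebraic_tensors_def)
  have "T (product_form (\<lambda>_. h)) = 0" if h: "\<forall>g\<in>(\<Union>x\<in>set xs. range x). blinfun_apply h g = 0" for h
  proof -
    have "mform_apply (product_form (\<lambda>_. h)) x = 0" if "x \<in> set xs" for x
      using h that by (auto simp: mform_apply_product_form)
    then have "map (mform_apply (product_form (\<lambda>_. h))) xs = map (\<lambda>_. 0) xs" by simp
    then show ?thesis by (simp only: T tensor_sum_def sum_list_0)
  qed
  then show ?thesis by (intro exI[of _ "\<Union>x\<in>set xs. range x"]) auto
qed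

lemma projective_moment_necessary:
  fixes X :: "'w \<Rightarrow> 'm::finite skorokhod"
  assumes "Bochner_integrable M
    (\<lambda>w. projective_power (X w) :: ('m skorokhod, 'l::finite) projective_tensor_power)"
  shows "(\<integral>\<^sup>+w. ennreal (norm (X w) ^ CARD('l)) \<partial>M) < \<infinity>"
    and "\<exists>A :: 'm \<Rightarrow> real set. (\<forall>i. countable (A i) \<and> A i \<subseteq> {0..1}) \<and>
        (\<forall>i. AE w in M. \<forall>t\<in>cbox 0 1. t $ i \<notin> A i \<longrightarrow> jump i (X w) t = 0)"
proof -
  define ev :: "('m skorokhod \<Rightarrow>\<^sub>L real) \<Rightarrow> ('m skorokhod, 'l) projective_alg \<Rightarrow> real"
    where "ev h c = Rep_projective_alg c (product_form (\<lambda>_. h))" for h c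
  have power: "ev h (Abs_projective_alg (tensor_sum [\<lambda>_. f])) = blinfun_apply h f ^ CARD('l)" for h f
    by (simp add: ev_def Abs_projective_alg_inverse algebraic_tensors_def)
       (simp add: tensor_sum_def mform_apply_product_form)
  have bound: "\<bar>ev h c\<bar> \<le> seminorm c" if "norm h \<le> 1" for h c
    unfolding ev_def seminorm_projective_alg.rep_eq
    using that Rep_projective_alg by (intro abs_product_form_le_projective) auto
  have zero: "\<exists>F. finite F \<and> (\<forall>h. (\<forall>g\<in>F. blinfun_apply h g = 0) \<longrightarrow> ev h c = 0)" for c
    unfolding ev_def by (rule algebraic_tensors_finite_support[OF Rep_projective_alg])
  note * = Bochner_integrable_powerD[of ev, OF _ bound power zero_less_card_finite zero
      assms[unfolded projective_power_def]]
  show "(\<integral>\<^sup>+w. ennreal (norm (X w) ^ CARD('l)) \<partial>M) < \<infinity>"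
    by (rule *(1)) (simp add: ev_def minus_projective_alg.rep_eq)
  show "\<exists>A :: 'm \<Rightarrow> real set. (\<forall>i. countable (A i) \<and> A i \<subseteq> {0..1}) \<and>
        (\<forall>i. AE w in M. \<forall>t\<in>cbox 0 1. t $ i \<notin> A i \<longrightarrow> jump i (X w) t = 0)"
    by (rule *(2)) (simp add: ev_def minus_projective_alg.rep_eq)
qed

lemma injective_moment_necessary:
  fixes X :: "'w \<Rightarrow> 'm::finite skorokhod"
  assumes "Bochner_integrable M
    (\<lambda>w. injective_power (X w) :: ('m skorokhod, 'l::finite) injective_tensor_power)"
  shows "(\<integral>\<^sup>+w. ennreal (norm (X w) ^ CARD('l)) \<partial>M) < \<infinity>"
    and "\<exists>A :: 'm \<Rightarrow> real set. (\<forall>i. countable (A i) \<and> A i \<subseteq> {0..1}) \<and>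
        (\<forall>i. AE w in M. \<forall>t\<in>cbox 0 1. t $ i \<notin> A i \<longrightarrow> jump i (X w) t = 0)"
proof -
  define ev :: "('m skorokhod \<Rightarrow>\<^sub>L real) \<Rightarrow> ('m skorokhod, 'l) injective_alg \<Rightarrow> real"
    where "ev h c = Rep_injective_alg c (product_form (\<lambda>_. h))" for h c
  have power: "ev h (Abs_injective_alg (tensor_sum [\<lambda>_. f])) = blinfun_apply h f ^ CARD('l)" for h f
    by (simp add: ev_def Abs_injective_alg_inverse algebraic_tensors_def)
       (simp add: tensor_sum_def mform_apply_product_form)
  have bound: "\<bar>ev h c\<bar> \<le> seminorm c" if "norm h \<le> 1" for h c
    unfolding ev_def seminorm_injective_alg.rep_eq
    using that Rep_injective_alg by (intro abs_product_form_le_injective) auto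
  have zero: "\<exists>F. finite F \<and> (\<forall>h. (\<forall>g\<in>F. blinfun_apply h g = 0) \<longrightarrow> ev h c = 0)" for c
    unfolding ev_def by (rule algebraic_tensors_finite_support[OF Rep_injective_alg])
  note * = Bochner_integrable_powerD[of ev, OF _ bound power zero_less_card_finite zero
      assms[unfolded injective_power_def]]
  show "(\<integral>\<^sup>+w. ennreal (norm (X w) ^ CARD('l)) \<partial>M) < \<infinity>"
    by (rule *(1)) (simp add: ev_def minus_injective_alg.rep_eq)
  show "\<exists>A :: 'm \<Rightarrow> real set. (\<forall>i. countable (A i) \<and> A i \<subseteq> {0..1}) \<and>
        (\<forall>i. AE w in M. \<forall>t\<in>cbox 0 1. t $ i \<notin> A i \<longrightarrow> jump i (X w) t = 0)"
    by (rule *(2)) (simp add: ev_def minus_injective_alg.rep_eq)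
qed

theorem theorem8p3:
  fixes M :: "'w measure"
    and X :: "'w \<Rightarrow> 'm::finite skorokhod"
  assumes "prob_space M"
    and "\<And>t. t \<in> cbox 0 1 \<Longrightarrow> (\<lambda>w. skorokhod_apply (X w) t) \<in> borel_measurable M"
  shows
    "(Bochner_integrable M
        (\<lambda>w. projective_power (X w) :: ('m skorokhod, 'l::finite) projective_tensor_power) \<longleftrightarrow>
      Bochner_integrable M
        (\<lambda>w. injective_power (X w) :: ('m skorokhod, 'l) injective_tensor_power)) \<and>
     (Bochner_integrable M
        (\<lambda>w. injective_power (X w) :: ('m skorokhod, 'l) injective_tensor_power) \<longleftrightarrow>
      (\<integral>\<^sup>+w. ennreal (norm (X w) ^ CARD('l)) \<partial>M) < \<infinity> \<and>
      (\<exists>A :: 'm \<Rightarrow> real set. (\<forall>i. countable (A i) \<and> A i \<subseteq> {0..1}) \<and>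
        (\<forall>i. AE w in M. \<forall>t\<in>cbox 0 1. t $ i \<notin> A i \<longrightarrow> jump i (X w) t = 0)))"
    (is "(?i \<longleftrightarrow> ?ii) \<and> (?ii \<longleftrightarrow> ?moment \<and> (\<exists>A. ?cond A))")
proof -
  \<comment> \<open>The equivalence passes through the third condition: it yields both moments, and
    each moment yields it back.\<close>
  have "?i \<and> ?ii" if "?moment" "?cond A" for A :: "'m \<Rightarrow> real set"
    using that
    by (intro conjI Bochner_integrable_power[where A = A and k = "CARD('l)"] assms(2) tendsto_projective_power
        tendsto_injective_power norm_projective_power_le[where 'l = 'l] norm_injective_power_le[where 'l = 'l]) auto
  moreover have "?moment \<and> (\<exists>A. ?cond A)" if ?i
    using projective_moment_necessary[OF that] by blast
  moreover have "?moment \<and> (\<exists>A. ?cond A)" if ?ii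
    using injective_moment_necessary[OF that] by blast
  ultimately show ?thesis by blast
qed

end
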